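(* Let $1\le r<p\le q<s\le\infty$, set $\alpha=\frac rp-\frac rq$ and let $w\in A_{q/r}\cap\mathrm{RH}_{(s/q)'}$. For any sparse family of cubes $\mathcal S\subset\mathscr D$, where $\mathscr D$ is a dyadic lattice, and any $f\in L^p(w^{p/q})$ and $g\in L^{q'}(w^{1-q'})$ we have $$\sum_{Q\in\mathcal S}\langle|f|\rangle_{\frac r{1+\alpha},Q}\langle|g|\rangle_{s',Q}|Q|^{1+\frac\alpha r}\lesssim[w]_{A_{q/r}}^\beta[w]_{\mathrm{RH}_{(s/q)'}}^\beta\|f\|_{L^p(w^{p/q})}\|g\|_{L^{q'}(w^{1-q'})}$$ with $$\beta=\max\Big(\frac{s(1-\frac\alpha r)-1}{s-q},\frac1{q-r}\Big).$$
   Context: The symbol $\lesssim$ denotes an inequality up to an implicit multiplicative constant, which may depend on $p,q,n$ but not on any of the functions (in particular weights) under consideration; the sparseness number of $\mathcal S$ is regarded as fixed. If $s=\infty$, the first entry of the maximum is read as its limit $1-\frac\alpha r$. Cubes in $\mathbb R^n$ have sides parallel to the axes. For a cube $Q$, $\mathcal D(Q)$ is the set of cubes obtained by repeated subdivision of $Q$ and its descendants into $2^n$ congruent subcubes. A dyadic lattice $\mathscr D$ is a collection of cubes such that (i) $\mathcal D(Q)\subseteq\mathscr D$ for each $Q\in\mathscr D$; (ii) any $Q',Q''\in\mathscr D$ have a common ancestor $Q\in\mathscr D$, i.e. $Q',Q''\in\mathcal D(Q)$; (iii) every compact set is contained in a cube of $\mathscr D$. A family $\mathcal S$ of cubes is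 $\eta$-sparse ($\eta\in(0,1)$) if for every $Q\in\mathcal S$ there is $E_Q\subseteq Q$ with $|E_Q|\ge\eta|Q|$ and the $E_Q$ are pairwise disjoint; sparse means $\eta$-sparse, with the sparseness number $\eta$ suppressed. For $h\ge0$ and $t>0$, $\langle h\rangle_{t,Q}:=\big(\frac1{|Q|}\int_Qh^t\big)^{1/t}$. A weight is a non-negative locally integrable function and $\|f\|_{L^p(w)}:=(\int|f|^pw)^{1/p}$. For $1<p<\infty$, $[w]_{A_p}:=\sup_Q\langle w\rangle_{1,Q}\langle w^{-1}\rangle_{\frac1{p-1},Q}$, and for $1\le t<\infty$, $[w]_{\mathrm{RH}_t}:=\sup_Q\langle w\rangle_{t,Q}/\langle w\rangle_{1,Q}$; the classes $A_p$, $\mathrm{RH}_t$ consist of weights with finite constant. Primes denote H\"older conjugates; for $s=\infty$, $(s/q)'=1$ and $[w]_{\mathrm{RH}_1}=1$.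
   Formalization: The implicit constant is allowed to depend on r and s as well as on p, q, n and the sparseness number; with dependence on p, q, n only the claim fails (w = 1, p = q, s = ∞, r → p). *)

theory Defs
  imports "HOL-Analysis.Analysis"
begin

(* Real powers on [0, \<infinity>], so that negative powers of a weight are \<infinity> where the
   weight vanishes.  In products, 0 * \<infinity> = 0 as usual in measure theory. *)
definition ennreal_powr :: "ennreal \<Rightarrow> real \<Rightarrow> ennreal" where
  "ennreal_powr x t =
     (if t = 0 then 1
      else if x = 0 then (if 0 < t then 0 else \<infinity>)
      else if x = \<infinity> then (if 0 < t then \<infinity> else 0)
      else ennreal (enn2real x powr t))"

(* Hoelder conjugate exponent for t in (1, \<infinity>]; the conjugate of \<infinity> is 1. *)
definition hconj :: "ereal \<Rightarrow> real" where
  "hconj t = (if t = \<infinity> then 1 else real_of_ereal t / (real_of_ereal t - 1))"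

(* Cubes are taken half-open, so that the 2^n congruent subcubes of a cube partition it. *)
definition cube :: "real ^ 'n \<Rightarrow> real \<Rightarrow> (real ^ 'n) set" where
  "cube a h = {x. \<forall>i. a $ i \<le> x $ i \<and> x $ i < a $ i + h}"

definition cubes :: "(real ^ 'n) set set" where
  "cubes = {cube a h | a h. 0 < h}"

(* A subset I of the coordinates selects one of the 2^n congruent subcubes: the one lying
   in the upper half of the cube exactly in the coordinate directions belonging to I. *)
inductive_set dyadic_subcubes :: "(real ^ 'n) set \<Rightarrow> (real ^ 'n) set set"
  for Q :: "(real ^ 'n) set" where
  self: "Q \<in> dyadic_subcubes Q"
| subdivide: "cube a h \<in> dyadic_subcubes Q \<Longrightarrow> 0 < h \<Longrightarrow>
    cube (\<chi> i. a $ i + (if i \<in> I then h / 2 else 0)) (h / 2) \<in> dyadic_subcubes Q"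

definition dyadic_lattice :: "(real ^ 'n) set set \<Rightarrow> bool" where
  "dyadic_lattice \<D> \<longleftrightarrow>
     \<D> \<subseteq> cubes \<and>
     (\<forall>Q\<in>\<D>. dyadic_subcubes Q \<subseteq> \<D>) \<and>
     (\<forall>Q'\<in>\<D>. \<forall>Q''\<in>\<D>. \<exists>Q\<in>\<D>. Q' \<in> dyadic_subcubes Q \<and> Q'' \<in> dyadic_subcubes Q) \<and>
     (\<forall>K. compact K \<longrightarrow> (\<exists>Q\<in>\<D>. K \<subseteq> Q))"

definition sparse_family :: "real \<Rightarrow> (real ^ 'n) set set \<Rightarrow> bool" where
  "sparse_family \<eta> \<S> \<longleftrightarrow>
     \<S> \<subseteq> cubes \<and>
     (\<exists>E. (\<forall>Q\<in>\<S>. E Q \<in> sets lebesgue \<and> E Q \<subseteq> Q \<and>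
                   ennreal \<eta> * emeasure lebesgue Q \<le> emeasure lebesgue (E Q)) \<and>
          disjoint_family_on E \<S>)"

definition cube_avg :: "real \<Rightarrow> (real ^ 'n) set \<Rightarrow> (real ^ 'n \<Rightarrow> ennreal) \<Rightarrow> ennreal" where
  "cube_avg t Q h =
     ennreal_powr ((\<integral>\<^sup>+x\<in>Q. ennreal_powr (h x) t \<partial>lebesgue) / emeasure lebesgue Q) (1 / t)"

definition weight :: "(real ^ 'n \<Rightarrow> real) \<Rightarrow> bool" where
  "weight w \<longleftrightarrow> (\<forall>x. 0 \<le> w x) \<and> w \<in> borel_measurable lebesgue \<and>
     (\<forall>K. compact K \<longrightarrow> set_integrable lebesgue K w)"

definition Ap_const :: "real \<Rightarrow> (real ^ 'n \<Rightarrow> real) \<Rightarrow> ennreal" where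
  "Ap_const p w =
     (SUP Q\<in>cubes. cube_avg 1 Q (\<lambda>x. ennreal (w x)) *
                   cube_avg (1 / (p - 1)) Q (\<lambda>x. inverse (ennreal (w x))))"

definition RH_const :: "real \<Rightarrow> (real ^ 'n \<Rightarrow> real) \<Rightarrow> ennreal" where
  "RH_const t w =
     (SUP Q\<in>cubes. cube_avg t Q (\<lambda>x. ennreal (w x)) / cube_avg 1 Q (\<lambda>x. ennreal (w x)))"

definition Ap_class :: "real \<Rightarrow> (real ^ 'n \<Rightarrow> real) set" where
  "Ap_class p = {w. weight w \<and> Ap_const p w < \<infinity>}"

definition RH_class :: "real \<Rightarrow> (real ^ 'n \<Rightarrow> real) set" where
  "RH_class t = {w. weight w \<and> RH_const t w < \<infinity>}"

(* The density v = w^a is passed as a [0, \<infinity>]-valued function since a may be negative. *)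
definition Lp_norm :: "real \<Rightarrow> (real ^ 'n \<Rightarrow> ennreal) \<Rightarrow> (real ^ 'n \<Rightarrow> complex) \<Rightarrow> ennreal" where
  "Lp_norm p v f =
     ennreal_powr (\<integral>\<^sup>+x. ennreal_powr (ennreal (cmod (f x))) p * v x \<partial>lebesgue) (1 / p)"

definition Lp_space :: "real \<Rightarrow> (real ^ 'n \<Rightarrow> ennreal) \<Rightarrow> (real ^ 'n \<Rightarrow> complex) set" where
  "Lp_space p v = {f \<in> borel_measurable lebesgue. Lp_norm p v f < \<infinity>}"

definition wpow :: "(real ^ 'n \<Rightarrow> real) \<Rightarrow> real \<Rightarrow> real ^ 'n \<Rightarrow> ennreal" where
  "wpow w a x = ennreal_powr (ennreal (w x)) a"

end

theory Submission
  imports Defs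
begin

text \<open>
  Put \<open>B = 1/r - 1/q\<close>, \<open>A = 1/q - 1/s\<close>, \<open>\<sigma> = w^(-1/(qB))\<close> and \<open>u = w^(1/(qA))\<close>, so that
  \<open>\<sigma>^B u^A = 1\<close>. With \<open>|f|^\<rho> = \<phi> \<sigma>\<close>, \<open>|g|^s' = \<psi> u\<close> and \<open>\<rho> = r/(1+\<alpha>)\<close>, the summand for \<open>Q\<close> becomes
  \<open>(\<phi>_Q)^(1/p+B) (\<psi>_Q)^(1/q'+A) L_Q \<sigma>(Q)^(1/p) u(Q)^(1/q')\<close>, where \<open>\<phi>_Q\<close>, \<open>\<psi>_Q\<close> are averages with
  respect to \<open>\<sigma>\<close>, \<open>u\<close> and \<open>L_Q = <\<sigma>>_Q^B <u>_Q^A\<close> satisfies \<open>L_Q^q \<le> [w]_A [w]_RH\<close>.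

  Freeze \<open>L_Q \<approx> 2^j\<close>. There \<open>\<lambda>_Q = \<sigma>(Q)^(1/p) u(Q)^(1/q')\<close> is comparable to a product of powers of the
  averages with total exponent below one, so a Kolmogorov type estimate shows that its sum over the
  \<open>Q' \<subseteq> Q\<close> in the family is \<open>O(\<lambda>_Q)\<close>. Hence the sum reduces to the stopping cubes of \<open>\<phi>\<close> and
  those of \<open>\<psi>\<close>. On the latter, Hoelder with exponents \<open>q\<close>, \<open>q'\<close> and the Carleson embedding cost the
  factor \<open>sup (\<sigma>(Q)/\<sigma>(E_Q))^(1/q)\<close>, which is \<open>O(2^(j/(qB)))\<close> because
  \<open>|E|^(A+B) \<le> \<sigma>(E)^B u(E)^A\<close>; on the former the factor is \<open>O(2^(j/(p'A)))\<close>. The sum over \<open>j\<close> is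
  geometric, and \<open>q \<beta> = 1 + max (1/(qB)) (1/(p'A))\<close>.
\<close>

subsection \<open>Hoelder and geometric sums\<close>

text \<open>The obstacle is that \<lambda>_Q has total exponent 1/p + 1/q' = 1 + (1/p - 1/q) \<ge> 1
  in the two averages, outside the range of Kolmogorov type estimates. On a level set of L_Q a
  factor L_Q^(-\<delta>) costs only a constant, and it lowers the total exponent by \<delta> (A +
  B). The packing constant of \<lambda>_Q is then independent of the weight. For this reason L_Q is
  frozen before any stopping cubes are chosen, and they are chosen anew inside each level.

  Only one of the two functions pays for the weight. A cube is charged to the smaller of its two
  stopping parents; there one function is summed over its own stopping cubes, which is free, and the
  other over general cubes, which costs sup \<sigma>(Q)/\<sigma>(E_Q) or its analogue for u. The
  paying function is needed only in l^(q/p), respectively l^(p'/q'), and both exponents are at least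
  1. Interpolating with the free bound on single terms lets the cost enter with power 1/q instead of
  1/p, respectively 1/p' instead of 1/q'; this gives the sharp \<beta>.\<close>

lemma weighted_amgm:
  fixes a b :: real
  assumes "0 < \<theta>" "\<theta> < 1" "0 \<le> a" "0 \<le> b"
  shows "a powr \<theta> * b powr (1 - \<theta>) \<le> \<theta> * a + (1 - \<theta>) * b"
proof (cases "a = 0 \<or> b = 0")
  case True
  then show ?thesis using assms by auto
next
  case False
  then show ?thesis using assms Youngs_inequality_0[of \<theta> "1 - \<theta>" a b] by simp
qed

lemma Holder_sum:
  fixes x y :: "'b \<Rightarrow> real"
  assumes S: "finite S" and nn: "\<And>i. i \<in> S \<Longrightarrow> 0 \<le> x i" "\<And>i. i \<in> S \<Longrightarrow> 0 \<le> y i"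
    and \<theta>: "0 < \<theta>" "\<theta> < 1"
  shows "(\<Sum>i\<in>S. x i powr \<theta> * y i powr (1 - \<theta>)) \<le> (\<Sum>i\<in>S. x i) powr \<theta> * (\<Sum>i\<in>S. y i) powr (1 - \<theta>)"
proof (cases "(\<Sum>i\<in>S. x i) = 0 \<or> (\<Sum>i\<in>S. y i) = 0")
  case True
  then have "(\<forall>i\<in>S. x i = 0) \<or> (\<forall>i\<in>S. y i = 0)"
    using S nn by (metis sum_nonneg_eq_0_iff)
  then have "(\<Sum>i\<in>S. x i powr \<theta> * y i powr (1 - \<theta>)) = 0"
    by (intro sum.neutral) auto
  then show ?thesis by simp
next
  case False
  define X where "X = (\<Sum>i\<in>S. x i)"
  define Y where "Y = (\<Sum>i\<in>S. y i)"
  have pos: "0 < X" "0 < Y"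
    using False sum_nonneg[of S x] sum_nonneg[of S y] nn unfolding X_def Y_def by force+
  have "(\<Sum>i\<in>S. x i powr \<theta> * y i powr (1 - \<theta>))
      = X powr \<theta> * Y powr (1 - \<theta>) * (\<Sum>i\<in>S. (x i / X) powr \<theta> * (y i / Y) powr (1 - \<theta>))"
    unfolding sum_distrib_left using nn pos
    by (intro sum.cong) (auto simp: powr_divide)
  also have "(\<Sum>i\<in>S. (x i / X) powr \<theta> * (y i / Y) powr (1 - \<theta>))
      \<le> (\<Sum>i\<in>S. \<theta> * (x i / X) + (1 - \<theta>) * (y i / Y))"
    using nn pos \<theta> by (intro sum_mono weighted_amgm) auto
  also have "\<dots> = \<theta> * (X / X) + (1 - \<theta>) * (Y / Y)"
    by (simp only: X_def Y_def sum.distrib sum_distrib_left[symmetric] sum_divide_distrib[symmetric])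
  also have "\<dots> = 1" using pos by simp
  finally show ?thesis using pos by (simp add: X_def Y_def mult_left_mono)
qed

text \<open>Termwise interpolation of l^k between l^1 and the supremum; it is used with k = q/p and
  k = p'/q'.\<close>

lemma powr_le_self_scaled:
  fixes v V k :: real
  assumes "0 \<le> v" "v \<le> V" "1 \<le> k"
  shows "v powr k \<le> V powr (k - 1) * v"
proof (cases "v = 0")
  case False
  then have "v powr k = v powr (k - 1) * v" using assms by (simp add: powr_diff)
  also have "\<dots> \<le> V powr (k - 1) * v"
    using assms by (intro mult_right_mono powr_mono2) auto
  finally show ?thesis .
qed auto

text \<open>The top term dominates: counting downwards from the floor of \<open>log 2 X\<close>
  embeds \<open>I\<close> into the exponents of one convergent series, so the number of terms does
  not matter.\<close>

lemma sum_powr_geometric_le: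
  fixes X c :: real and I :: "int set"
  assumes I: "finite I" and c: "0 < c" and X: "0 < X" and le: "\<And>i. i \<in> I \<Longrightarrow> 2 powr i \<le> X"
  shows "(\<Sum>i\<in>I. 2 powr (c * i)) \<le> X powr c / (1 - 2 powr (- c))"
proof -
  define N where "N = \<lfloor>log 2 X\<rfloor>"
  have r: "2 powr (-c) < 1" using c by (simp add: powr_less_one)
  have N: "i \<le> N" if "i \<in> I" for i
    using le[OF that] X unfolding N_def by (simp add: le_floor_iff le_log_iff)
  have NX: "2 powr N \<le> X" using X by (simp add: N_def powr_le_iff)
  have inj: "inj_on (\<lambda>i. nat (N - i)) I" using N by (intro inj_onI) (fastforce simp: nat_eq_iff)
  have "(\<Sum>i\<in>I. 2 powr (c * i)) = (\<Sum>i\<in>I. 2 powr (c * N) * (2 powr (-c)) ^ nat (N - i))"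
  proof (intro sum.cong refl)
    fix i assume "i \<in> I"
    then have n: "real (nat (N - i)) = real_of_int N - i" using N by simp
    have "2 powr (c * N) * (2 powr (-c)) ^ nat (N - i) = 2 powr (c * N + (real_of_int N - i) * (- c))"
      by (simp only: powr_power powr_add n simp_thms zero_neq_numeral not_False_eq_True)
    also have "c * N + (real_of_int N - i) * (- c) = c * i" by (simp add: algebra_simps)
    finally show "2 powr (c * i) = 2 powr (c * N) * (2 powr (-c)) ^ nat (N - i)" by simp
  qed
  also have "\<dots> = 2 powr (c * N) * (\<Sum>n\<in>(\<lambda>i. nat (N - i)) ` I. (2 powr (-c)) ^ n)"
    by (simp add: sum_distrib_left sum.reindex[OF inj])
  also have "(\<Sum>n\<in>(\<lambda>i. nat (N - i)) ` I. (2 powr (-c)) ^ n) \<le> (\<Sum>n. (2 powr (-c)) ^ n)"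
    using I r by (intro sum_le_suminf summable_geometric) auto
  also have "\<dots> = 1 / (1 - 2 powr (-c))" using r by (intro suminf_geometric) auto
  also have "2 powr (c * N) = (2 powr N) powr c" by (simp add: powr_powr mult.commute)
  also have "\<dots> * (1 / (1 - 2 powr (-c))) \<le> X powr c * (1 / (1 - 2 powr (-c)))"
    using NX c r by (intro mult_right_mono powr_mono2) auto
  finally show ?thesis by simp
qed

lemma sum_powr_geometric_ge:
  fixes X c :: real and I :: "int set"
  assumes I: "finite I" and c: "0 < c" and X: "0 < X" and le: "\<And>i. i \<in> I \<Longrightarrow> X \<le> 2 powr i"
  shows "(\<Sum>i\<in>I. 2 powr (- (c * i))) \<le> X powr (- c) / (1 - 2 powr (- c))"
proof -
  have "(\<Sum>i\<in>I. 2 powr (- (c * i))) = (\<Sum>i\<in>uminus ` I. 2 powr (c * i))"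
    by (subst sum.reindex) (auto simp: inj_on_def)
  also have "\<dots> \<le> (1 / X) powr c / (1 - 2 powr (- c))"
    using assms by (intro sum_powr_geometric_le) (auto simp: powr_minus field_simps)
  finally show ?thesis using X by (simp add: powr_divide powr_minus_divide)
qed

subsection \<open>Stopping sets of laminar families\<close>

definition laminar :: "'a set set \<Rightarrow> bool" where
  "laminar S \<longleftrightarrow> (\<forall>Q\<in>S. \<forall>R\<in>S. Q \<subseteq> R \<or> R \<subseteq> Q \<or> Q \<inter> R = {})"

definition lev :: "'a set set \<Rightarrow> ('a set \<Rightarrow> int) \<Rightarrow> 'a set \<Rightarrow> int" where
  "lev S k Q = Max (k ` {R \<in> S. Q \<subseteq> R})"

text \<open>A level is propagated from a set to all its subsets, so it only increases downwards, and
  the sets of \<open>stopping S k\<close> through a given point have pairwise distinct levels.\<close>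

definition stopping :: "'a set set \<Rightarrow> ('a set \<Rightarrow> int) \<Rightarrow> 'a set set" where
  "stopping S k = {R \<in> S. \<forall>R'\<in>S. R \<subset> R' \<longrightarrow> lev S k R' < lev S k R}"

lemma laminar_subset: "laminar S \<Longrightarrow> T \<subseteq> S \<Longrightarrow> laminar T"
  unfolding laminar_def by blast

lemma lev_antimono:
  assumes "finite S" "R \<in> S" "Q \<subseteq> R"
  shows "lev S k R \<le> lev S k Q"
  unfolding lev_def
proof (rule Max_mono)
  show "k ` {R' \<in> S. R \<subseteq> R'} \<subseteq> k ` {R' \<in> S. Q \<subseteq> R'}" using assms(3) by (intro image_mono) blast
qed (use assms in auto)

lemma lev_ge: "finite S \<Longrightarrow> R \<in> S \<Longrightarrow> Q \<subseteq> R \<Longrightarrow> k R \<le> lev S k Q"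
  unfolding lev_def by (intro Max_ge) auto

lemma lev_attained:
  assumes "finite S" "Q \<in> S"
  obtains R where "R \<in> S" "Q \<subseteq> R" "lev S k Q = k R"
proof -
  have "lev S k Q \<in> k ` {R \<in> S. Q \<subseteq> R}"
    unfolding lev_def using assms by (intro Max_in) auto
  then show ?thesis using that by auto
qed

lemma stopping_subset: "stopping S k \<subseteq> S"
  unfolding stopping_def by blast

text \<open>An ancestor attaining the running maximum already has that level, and strictness at a
  stopping set leaves only the set itself. Hence at stopping sets the level is a genuine lower bound
  for the own average, as the Carleson embedding requires.\<close>

lemma lev_stopping:
  assumes S: "finite S" and R: "R \<in> stopping S k"
  shows "lev S k R = k R"
proof -
  have "R \<in> S" using R stopping_subset by blast
  then obtain R' where R': "R' \<in> S" "R \<subseteq> R'" "lev S k R = k R'" using lev_attained[OF S] by blast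
  moreover have "k R' \<le> lev S k R'" using S R' by (intro lev_ge) auto
  ultimately show ?thesis using R unfolding stopping_def by fastforce
qed

text \<open>A maximal ancestor with the level of \<open>Q\<close> works: levels do not increase
  upwards, so every larger member of \<open>S\<close> has a strictly smaller one.\<close>

lemma stopping_parent:
  assumes S: "finite S" and Q: "Q \<in> S"
  obtains R where "R \<in> stopping S k" "Q \<subseteq> R" "lev S k R = lev S k Q"
proof -
  let ?T = "{R \<in> S. Q \<subseteq> R \<and> lev S k R = lev S k Q}"
  have "finite ?T" "?T \<noteq> {}" using S Q by auto
  then obtain R where R: "R \<in> ?T" and max: "\<forall>R'\<in>?T. R \<subseteq> R' \<longrightarrow> R = R'"
    using finite_has_maximal[of ?T] by blast
  have "lev S k R' < lev S k R" if "R' \<in> S" "R \<subset> R'" for R'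
  proof -
    have "lev S k R' \<le> lev S k R" using S that by (intro lev_antimono) auto
    moreover have "lev S k R' \<noteq> lev S k R"
    proof
      assume "lev S k R' = lev S k R"
      then have "R' \<in> ?T" using R that by auto
      then show False using max that by blast
    qed
    ultimately show ?thesis by simp
  qed
  then have "R \<in> stopping S k" using R unfolding stopping_def by simp
  then show ?thesis using R that by simp
qed

lemma stopping_lev_inj:
  assumes "laminar S" "x \<in> R" "x \<in> R'" "R \<in> stopping S k" "R' \<in> stopping S k"
    "lev S k R = lev S k R'"
  shows "R = R'"
proof (rule ccontr)
  assume "R \<noteq> R'"
  have "R \<in> S" "R' \<in> S" using assms stopping_subset by blast+
  then have "R \<subset> R' \<or> R' \<subset> R" using \<open>R \<noteq> R'\<close> assms(1-3) unfolding laminar_def by blast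
  then show False using assms \<open>R \<in> S\<close> \<open>R' \<in> S\<close> unfolding stopping_def by force
qed

text \<open>\<open>measure\<close> is 0 on sets of infinite measure, so positivity of
  \<open>measure\<close> also encodes finiteness. The sparse locales below state both at once in
  this way.\<close>

lemma emeasure_finite_of_measure_pos:
  assumes "0 < measure N R"
  shows "emeasure N R < \<infinity>" "emeasure N R = ennreal (measure N R)"
proof -
  have "emeasure N R \<noteq> \<infinity>" using assms by (auto simp: measure_def)
  then show "emeasure N R < \<infinity>" "emeasure N R = ennreal (measure N R)"
    by (auto simp: top.not_eq_extremum emeasure_eq_ennreal_measure)
qed

lemma measure_mono_of_pos:
  assumes "Q \<in> sets N" "R \<in> sets N" "Q \<subseteq> R" "0 < measure N R"
  shows "measure N Q \<le> measure N R"
  using assms emeasure_finite_of_measure_pos[OF assms(4)]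
  by (intro measure_mono_fmeasurable) (auto simp: fmeasurable_def)

text \<open>The charging principle: each \<open>Q\<close> is paid for at some \<open>R\<close> above
  it, and the order of summation is exchanged. A set below several \<open>R\<close> is counted
  repeatedly, which only enlarges the right side.\<close>

lemma sum_le_sum_cover:
  fixes a b m :: "'a set \<Rightarrow> real"
  assumes fin: "finite T" "finite P"
    and cover: "\<And>Q. Q \<in> T \<Longrightarrow> \<exists>R\<in>P. Q \<subseteq> R \<and> a Q \<le> b R"
    and nn: "\<And>R. R \<in> P \<Longrightarrow> 0 \<le> b R" "\<And>Q. Q \<in> T \<Longrightarrow> 0 \<le> m Q"
  shows "(\<Sum>Q\<in>T. a Q * m Q) \<le> (\<Sum>R\<in>P. b R * (\<Sum>Q\<in>{Q\<in>T. Q \<subseteq> R}. m Q))"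
proof -
  have "(\<Sum>Q\<in>T. a Q * m Q) \<le> (\<Sum>Q\<in>T. \<Sum>R\<in>{R\<in>P. Q \<subseteq> R}. b R * m Q)"
  proof (rule sum_mono)
    fix Q assume Q: "Q \<in> T"
    then obtain R where R: "R \<in> P" "Q \<subseteq> R" "a Q \<le> b R" using cover by blast
    have "a Q * m Q \<le> b R * m Q" using R nn Q by (intro mult_right_mono) auto
    also have "\<dots> \<le> (\<Sum>R\<in>{R\<in>P. Q \<subseteq> R}. b R * m Q)"
      using R fin nn Q by (intro member_le_sum) auto
    finally show "a Q * m Q \<le> (\<Sum>R\<in>{R\<in>P. Q \<subseteq> R}. b R * m Q)" .
  qed
  also have "\<dots> = (\<Sum>R\<in>P. \<Sum>Q\<in>{Q\<in>T. Q \<subseteq> R}. b R * m Q)"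
    using fin by (rule sum.swap_restrict)
  finally show ?thesis by (simp add: sum_distrib_left)
qed

subsection \<open>Carleson embedding and sparse sums\<close>

text \<open>Subtraction of \<open>c / 2\<close> is legitimate because \<open>c\<close> is a real
  number; \<open>X\<close> may be infinite.\<close>

lemma ennreal_absorb_half:
  fixes X :: ennreal and c :: real
  assumes "0 \<le> c" "ennreal c \<le> X + ennreal (c / 2)"
  shows "ennreal c \<le> 2 * X"
proof (cases X)
  case (real x)
  have "ennreal c \<le> ennreal (x + c / 2)" using assms real by simp
  then have "c \<le> x + c / 2" using real assms(1) by (subst (asm) ennreal_le_iff) auto
  then have "ennreal c \<le> ennreal (2 * x)" by (intro ennreal_leI) simp
  then show ?thesis using real by (simp add: ennreal_mult)
next
  case top
  then show ?thesis by (simp add: ennreal_mult_top)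
qed

lemma carleson_embedding:
  fixes \<phi> :: "'a \<Rightarrow> real" and l :: "'a set \<Rightarrow> int" and m :: real
  assumes m: "1 < m" and F: "finite F" "F \<subseteq> sets N"
    and fin: "\<And>R. R \<in> F \<Longrightarrow> emeasure N R < \<infinity>"
    and \<phi>[measurable]: "\<phi> \<in> borel_measurable N" and nn: "\<And>x. 0 \<le> \<phi> x"
    and inj: "\<And>x R R'. x \<in> R \<Longrightarrow> x \<in> R' \<Longrightarrow> R \<in> F \<Longrightarrow> R' \<in> F \<Longrightarrow> l R = l R' \<Longrightarrow> R = R'"
    and avg: "\<And>R. R \<in> F \<Longrightarrow> ennreal (2 powr l R) * emeasure N R \<le> (\<integral>\<^sup>+x\<in>R. ennreal (\<phi> x) \<partial>N)"
  shows "(\<Sum>R\<in>F. ennreal (2 powr (m * l R)) * emeasure N R)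
     \<le> ennreal (2 powr m / (1 - 2 powr (- (m - 1)))) * (\<integral>\<^sup>+x. ennreal (\<phi> x powr m) \<partial>N)"
proof -
  \<comment> \<open>The part of \<open>\<phi>\<close> below half the average of \<open>R\<close> carries at most half of the integral over \<open>R\<close>.
    After discarding it, only the levels below \<open>2 \<phi>(x)\<close> contribute at \<open>x\<close>, so that the
    pointwise sum is geometric and no maximal function is needed.\<close>
  define h where "h R x = (if x \<in> R \<and> 2 powr l R \<le> 2 * \<phi> x then \<phi> x else 0)" for R x
  have h_meas: "h R \<in> borel_measurable N" if "R \<in> F" for R
  proof -
    have [measurable]: "R \<in> sets N" using F that by auto
    show ?thesis unfolding h_def by measurable
  qed
  have half: "ennreal (2 powr l R) * emeasure N R \<le> 2 * (\<integral>\<^sup>+x. ennreal (h R x) \<partial>N)" if R: "R \<in> F" for R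
  proof -
    have [measurable]: "R \<in> sets N" "h R \<in> borel_measurable N" using F R h_meas by auto
    define c where "c = 2 powr l R * measure N R"
    have e: "emeasure N R = ennreal (measure N R)"
      using fin[OF R] by (intro emeasure_eq_ennreal_measure) auto
    have c: "ennreal c = ennreal (2 powr l R) * emeasure N R"
      unfolding c_def e by (simp add: ennreal_mult)
    have "ennreal c \<le> (\<integral>\<^sup>+x\<in>R. ennreal (\<phi> x) \<partial>N)" unfolding c by (rule avg[OF R])
    also have "\<dots> \<le> (\<integral>\<^sup>+x. ennreal (h R x) + ennreal (2 powr l R / 2) * indicator R x \<partial>N)"
    proof (rule nn_integral_mono)
      fix x
      show "ennreal (\<phi> x) * indicator R x \<le> ennreal (h R x) + ennreal (2 powr l R / 2) * indicator R x"
        using nn[of x] unfolding h_def by (auto simp: indicator_def intro!: ennreal_leI)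
    qed
    also have "\<dots> = (\<integral>\<^sup>+x. ennreal (h R x) \<partial>N) + ennreal (2 powr l R / 2) * emeasure N R"
      by (subst nn_integral_add) (auto simp: nn_integral_cmult_indicator)
    also have "ennreal (2 powr l R / 2) * emeasure N R = ennreal (c / 2)"
      unfolding c_def e by (simp add: ennreal_mult[symmetric] )
    finally show ?thesis unfolding c[symmetric] by (intro ennreal_absorb_half) (auto simp: c_def)
  qed
  have "(\<Sum>R\<in>F. ennreal (2 powr (m * l R)) * emeasure N R)
     \<le> (\<Sum>R\<in>F. ennreal (2 powr ((m - 1) * l R)) * (2 * (\<integral>\<^sup>+x. ennreal (h R x) \<partial>N)))"
  proof (rule sum_mono)
    fix R assume R: "R \<in> F"
    have "ennreal (2 powr (m * l R)) * emeasure N R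
        = ennreal (2 powr ((m - 1) * l R)) * (ennreal (2 powr l R) * emeasure N R)"
      by (simp add: ennreal_mult[symmetric] mult.assoc[symmetric] powr_add[symmetric] algebra_simps)
    also have "\<dots> \<le> ennreal (2 powr ((m - 1) * l R)) * (2 * (\<integral>\<^sup>+x. ennreal (h R x) \<partial>N))"
      using half[OF R] by (intro mult_left_mono) auto
    finally show "ennreal (2 powr (m * l R)) * emeasure N R
        \<le> ennreal (2 powr ((m - 1) * l R)) * (2 * (\<integral>\<^sup>+x. ennreal (h R x) \<partial>N))" .
  qed
  also have "\<dots> = (\<Sum>R\<in>F. (\<integral>\<^sup>+x. ennreal (2 * 2 powr ((m - 1) * l R) * h R x) \<partial>N))"
  proof (intro sum.cong refl)
    fix R assume R: "R \<in> F"
    have [measurable]: "h R \<in> borel_measurable N" using R h_meas by auto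
    have "(\<integral>\<^sup>+x. ennreal (2 * 2 powr ((m - 1) * l R) * h R x) \<partial>N)
       = (\<integral>\<^sup>+x. ennreal (2 * 2 powr ((m - 1) * l R)) * ennreal (h R x) \<partial>N)"
      by (simp add: ennreal_mult' )
    also have "\<dots> = ennreal (2 * 2 powr ((m - 1) * l R)) * (\<integral>\<^sup>+x. ennreal (h R x) \<partial>N)"
      by (rule nn_integral_cmult) measurable
    finally show "ennreal (2 powr ((m - 1) * l R)) * (2 * (\<integral>\<^sup>+x. ennreal (h R x) \<partial>N))
       = (\<integral>\<^sup>+x. ennreal (2 * 2 powr ((m - 1) * l R) * h R x) \<partial>N)"
      by (simp add: ennreal_mult ac_simps)
  qed
  also have "\<dots> = (\<integral>\<^sup>+x. (\<Sum>R\<in>F. ennreal (2 * 2 powr ((m - 1) * l R) * h R x)) \<partial>N)"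
    using h_meas by (intro nn_integral_sum[symmetric]) measurable
  also have "\<dots> \<le> (\<integral>\<^sup>+x. ennreal (2 powr m / (1 - 2 powr (- (m - 1)))) * ennreal (\<phi> x powr m) \<partial>N)"
  proof (rule nn_integral_mono)
    fix x
    define G where "G = {R\<in>F. x \<in> R \<and> 2 powr l R \<le> 2 * \<phi> x}"
    have hnn: "0 \<le> h R x" for R using nn by (simp add: h_def)
    have "(\<Sum>R\<in>F. 2 * 2 powr ((m - 1) * l R) * h R x) \<le> 2 powr m / (1 - 2 powr (- (m - 1))) * \<phi> x powr m"
    proof (cases "\<phi> x = 0")
      case True
      then show ?thesis by (simp add: h_def)
    next
      case False
      then have pos: "0 < \<phi> x" using nn[of x] by simp
      have inj': "inj_on l G" unfolding G_def using inj by (intro inj_onI) auto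
      have "(\<Sum>R\<in>F. 2 * 2 powr ((m - 1) * l R) * h R x) = (\<Sum>R\<in>G. 2 * 2 powr ((m - 1) * l R) * \<phi> x)"
        unfolding G_def h_def using F by (intro sum.mono_neutral_cong_right) auto
      also have "\<dots> = 2 * \<phi> x * (\<Sum>i\<in>l ` G. 2 powr ((m - 1) * i))"
        by (simp add: sum.reindex[OF inj'] sum_distrib_left mult_ac)
      also have "(\<Sum>i\<in>l ` G. 2 powr ((m - 1) * i)) \<le> (2 * \<phi> x) powr (m - 1) / (1 - 2 powr (- (m - 1)))"
        using F m pos by (intro sum_powr_geometric_le) (auto simp: G_def)
      also have "2 * \<phi> x * ((2 * \<phi> x) powr (m - 1) / (1 - 2 powr (- (m - 1))))
          = (2 * \<phi> x) powr m / (1 - 2 powr (- (m - 1)))"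
        using pos by (simp add: powr_diff)
      finally show ?thesis using pos by (simp add: powr_mult)
    qed
    then show "(\<Sum>R\<in>F. ennreal (2 * 2 powr ((m - 1) * l R) * h R x))
        \<le> ennreal (2 powr m / (1 - 2 powr (- (m - 1)))) * ennreal (\<phi> x powr m)"
      using hnn m by (subst sum_ennreal) (auto simp: ennreal_mult[symmetric] powr_less_one less_imp_le intro!: ennreal_leI)
  qed
  also have "\<dots> = ennreal (2 powr m / (1 - 2 powr (- (m - 1)))) * (\<integral>\<^sup>+x. ennreal (\<phi> x powr m) \<partial>N)"
    by (rule nn_integral_cmult) measurable
  finally show ?thesis .
qed

text \<open>At a fixed point the levels are distinct and at least \<open>l0\<close>, so the sum is a
  geometric tail starting at \<open>l0\<close>; integrating this pointwise bound over
  \<open>Q0\<close> gives the claim.\<close>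

lemma sum_powr_level_measure_le:
  fixes l :: "'a set \<Rightarrow> int" and c :: real
  assumes c: "0 < c" and F: "finite F" "F \<subseteq> sets N"
    and Q0: "Q0 \<in> sets N" "emeasure N Q0 < \<infinity>"
    and sub: "\<And>R. R \<in> F \<Longrightarrow> R \<subseteq> Q0" and ge: "\<And>R. R \<in> F \<Longrightarrow> l0 \<le> l R"
    and inj: "\<And>x R R'. x \<in> R \<Longrightarrow> x \<in> R' \<Longrightarrow> R \<in> F \<Longrightarrow> R' \<in> F \<Longrightarrow> l R = l R' \<Longrightarrow> R = R'"
  shows "(\<Sum>R\<in>F. 2 powr (- (c * l R)) * measure N R) \<le> 2 powr (- (c * l0)) / (1 - 2 powr (- c)) * measure N Q0"
proof -
  define C where "C = 2 powr (- (c * l0)) / (1 - 2 powr (- c))"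
  have Cnn: "0 \<le> C" using c by (simp add: C_def powr_less_one less_imp_le)
  have fin: "emeasure N R = ennreal (measure N R)" if "R \<in> F" for R
    using emeasure_mono[OF sub[OF that] Q0(1)] Q0(2) by (intro emeasure_eq_ennreal_measure) (auto simp: top_unique)
  have "ennreal (\<Sum>R\<in>F. 2 powr (- (c * l R)) * measure N R) = (\<Sum>R\<in>F. ennreal (2 powr (- (c * l R))) * emeasure N R)"
    by (subst sum_ennreal[symmetric]) (auto simp: fin ennreal_mult)
  also have "\<dots> = (\<Sum>R\<in>F. \<integral>\<^sup>+x. ennreal (2 powr (- (c * l R))) * indicator R x \<partial>N)"
    using F by (intro sum.cong refl nn_integral_cmult_indicator[symmetric]) auto
  also have "\<dots> = (\<integral>\<^sup>+x. (\<Sum>R\<in>F. ennreal (2 powr (- (c * l R))) * indicator R x) \<partial>N)"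
  proof (rule nn_integral_sum[symmetric])
    fix R assume "R \<in> F"
    then have [measurable]: "R \<in> sets N" using F by auto
    show "(\<lambda>x. ennreal (2 powr (- (c * l R))) * indicator R x) \<in> borel_measurable N" by measurable
  qed
  also have "\<dots> \<le> (\<integral>\<^sup>+x. ennreal C * indicator Q0 x \<partial>N)"
  proof (rule nn_integral_mono)
    fix x
    define G where "G = {R\<in>F. x \<in> R}"
    have inj': "inj_on l G" unfolding G_def using inj by (intro inj_onI) auto
    show "(\<Sum>R\<in>F. ennreal (2 powr (- (c * l R))) * indicator R x) \<le> ennreal C * indicator Q0 x"
    proof (cases "x \<in> Q0")
      case False
      then have "x \<notin> R" if "R \<in> F" for R using sub that by auto
      then show ?thesis by simp
    next
      case True
      have "(\<Sum>R\<in>F. ennreal (2 powr (- (c * l R))) * indicator R x) = (\<Sum>R\<in>G. ennreal (2 powr (- (c * l R))))"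
        unfolding G_def using F by (intro sum.mono_neutral_cong_right) (auto simp: indicator_def)
      also have "\<dots> = ennreal (\<Sum>i\<in>l ` G. 2 powr (- (c * i)))"
        by (simp add: sum.reindex[OF inj'])
      also have "\<dots> \<le> ennreal C"
      proof (rule ennreal_leI)
        have "(\<Sum>i\<in>l ` G. 2 powr (- (c * i))) \<le> (2 powr l0) powr (- c) / (1 - 2 powr (- c))"
          using F c ge by (intro sum_powr_geometric_ge) (auto simp: G_def)
        then show "(\<Sum>i\<in>l ` G. 2 powr (- (c * i))) \<le> C"
          unfolding C_def by (simp add: powr_powr mult.commute)
      qed
      finally show ?thesis using True by simp
    qed
  qed
  also have "\<dots> = ennreal C * emeasure N Q0"
    using Q0 by (intro nn_integral_cmult_indicator) auto
  also have "\<dots> = ennreal (C * measure N Q0)"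
    using Q0 Cnn by (simp add: emeasure_eq_ennreal_measure ennreal_mult)
  finally show ?thesis using Cnn unfolding C_def[symmetric] by (subst (asm) ennreal_le_iff) auto
qed

section \<open>Sparse laminar families in an abstract measure space\<close>

text \<open>Of the dyadic lattice only laminarity survives. The sets \<open>E Q\<close> are a
  parameter, so that every further measure on the same sigma-algebra is compared on the same
  disjoint sets.\<close>

locale sparse_laminar =
  fixes M :: "'a measure" and S :: "'a set set" and E :: "'a set \<Rightarrow> 'a set" and \<eta> :: real
  assumes finite_S: "finite S" and laminar_S: "laminar S" and S_sets: "S \<subseteq> sets M"
    and E_sets: "Q \<in> S \<Longrightarrow> E Q \<in> sets M" and E_sub: "Q \<in> S \<Longrightarrow> E Q \<subseteq> Q"
    and M_pos: "Q \<in> S \<Longrightarrow> 0 < measure M Q"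
    and E_large: "Q \<in> S \<Longrightarrow> \<eta> * measure M Q \<le> measure M (E Q)"
    and E_disj: "disjoint_family_on E S" and \<eta>_pos: "0 < \<eta>"
begin

lemma sub_family:
  assumes T: "T \<subseteq> S"
  shows "sparse_laminar M T E \<eta>"
proof
  show "finite T" using T finite_S by (rule finite_subset)
  show "laminar T" using laminar_S T by (rule laminar_subset)
  show "disjoint_family_on E T" using T E_disj by (rule disjoint_family_on_mono)
  show "T \<subseteq> sets M" using T S_sets by simp
qed (use T E_sets E_sub M_pos E_large \<eta>_pos in blast)+

lemma sum_E_le:
  assumes N: "sets N = sets M" and R: "R \<in> S" "0 < measure N R" and T: "T \<subseteq> S" "\<And>Q. Q \<in> T \<Longrightarrow> Q \<subseteq> R"
  shows "(\<Sum>Q\<in>T. measure N (E Q)) \<le> measure N R"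
proof -
  have RN: "R \<in> sets N" using N R S_sets by auto
  have fin: "emeasure N R \<noteq> \<infinity>" using R by (auto simp: measure_def)
  have T': "finite T" "disjoint_family_on E T"
    using T finite_S E_disj by (auto intro: finite_subset disjoint_family_on_mono)
  have sub: "E Q \<in> sets N" "E Q \<subseteq> R" if "Q \<in> T" for Q
    using N E_sets E_sub T that by blast+
  have "emeasure N (E Q) \<noteq> \<infinity>" if "Q \<in> T" for Q
    using emeasure_mono[OF sub(2)[OF that] RN] fin by (auto simp: top_unique)
  then have "(\<Sum>Q\<in>T. measure N (E Q)) = measure N (\<Union>Q\<in>T. E Q)"
    using T' sub by (intro measure_finite_Union[symmetric]) auto
  also have "\<dots> \<le> measure N R"
    using T' sub RN R by (intro measure_mono_of_pos) auto
  finally show ?thesis .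
qed

lemma packing:
  assumes R: "R \<in> S"
  shows "(\<Sum>Q\<in>{Q\<in>S. Q \<subseteq> R}. measure M Q) \<le> measure M R / \<eta>"
proof -
  have "\<eta> * (\<Sum>Q\<in>{Q\<in>S. Q \<subseteq> R}. measure M Q) \<le> (\<Sum>Q\<in>{Q\<in>S. Q \<subseteq> R}. measure M (E Q))"
    unfolding sum_distrib_left using E_large by (intro sum_mono) auto
  also have "\<dots> \<le> measure M R" using R M_pos by (intro sum_E_le) auto
  finally show ?thesis using \<eta>_pos by (simp add: field_simps)
qed

text \<open>A Kolmogorov type estimate. On a stopping set of level k the measure M is at most 2^(-k)
  times N; trading M for N leaves the factor 2^(-(1-z)k), which is summable over the levels at a
  point because z < 1.\<close>

lemma sum_avg_powr_le:
  assumes N: "sets N = sets M" and N_pos: "\<And>Q. Q \<in> S \<Longrightarrow> 0 < measure N Q"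
    and z: "0 < z" "z < 1" and Q0: "Q0 \<in> S"
  shows "(\<Sum>Q\<in>{Q\<in>S. Q \<subseteq> Q0}. (measure N Q / measure M Q) powr z * measure M Q)
     \<le> 2 / (1 - 2 powr (- (1 - z))) / \<eta> * ((measure N Q0 / measure M Q0) powr z * measure M Q0)"
proof -
  define T where "T = {Q\<in>S. Q \<subseteq> Q0}"
  have "T \<subseteq> S" by (auto simp: T_def)
  interpret T: sparse_laminar M T E \<eta> by (rule sub_family) fact
  define a where "a Q = measure N Q / measure M Q" for Q
  define k where "k Q = \<lfloor>log 2 (a Q)\<rfloor>" for Q
  define P where "P = stopping T k"
  have apos: "0 < a Q" if "Q \<in> T" for Q using that \<open>T \<subseteq> S\<close> N_pos M_pos by (auto simp: a_def)
  have k1: "2 powr k Q \<le> a Q" if "Q \<in> T" for Q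
    using apos[OF that] by (simp add: k_def powr_le_iff)
  have k2: "a Q \<le> 2 powr (k Q + 1)" if "Q \<in> T" for Q
  proof -
    have "log 2 (a Q) \<le> k Q + 1" unfolding k_def by linarith
    then show ?thesis using apos[OF that] by (simp add: log_le_iff)
  qed
  have P: "P \<subseteq> T" "finite P" using stopping_subset T.finite_S finite_subset unfolding P_def by blast+
  have Q0T: "Q0 \<in> T" using Q0 by (simp add: T_def)
  have "(\<Sum>Q\<in>T. a Q powr z * measure M Q)
      \<le> (\<Sum>R\<in>P. 2 powr (z * (lev T k R + 1)) * (\<Sum>Q\<in>{Q\<in>T. Q \<subseteq> R}. measure M Q))"
  proof (rule sum_le_sum_cover[where a="\<lambda>Q. a Q powr z"])
    fix Q assume Q: "Q \<in> T"
    obtain R where R: "R \<in> P" "Q \<subseteq> R" "lev T k R = lev T k Q"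
      using stopping_parent[OF T.finite_S Q] unfolding P_def by metis
    have "k Q \<le> lev T k Q" using Q T.finite_S by (intro lev_ge) auto
    then have "2 powr (k Q + 1) \<le> 2 powr (lev T k R + 1)" using R by simp
    then have "a Q \<le> 2 powr (lev T k R + 1)" using k2[OF Q] by linarith
    then have "a Q powr z \<le> (2 powr (lev T k R + 1)) powr z"
      using apos[OF Q] z by (intro powr_mono2) auto
    then show "\<exists>R\<in>P. Q \<subseteq> R \<and> a Q powr z \<le> 2 powr (z * (lev T k R + 1))"
      using R by (auto simp: powr_powr mult.commute)
  qed (use T.finite_S P in auto)
  also have "\<dots> \<le> (\<Sum>R\<in>P. 2 powr z / \<eta> * (2 powr (- ((1 - z) * lev T k R)) * measure N R))"
  proof (rule sum_mono)
    fix R assume R: "R \<in> P"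
    then have RT: "R \<in> T" using P by auto
    have l: "lev T k R = k R" using R unfolding P_def by (intro lev_stopping T.finite_S)
    have "2 powr (z * (lev T k R + 1)) * (\<Sum>Q\<in>{Q\<in>T. Q \<subseteq> R}. measure M Q)
        \<le> 2 powr (z * (lev T k R + 1)) * (measure M R / \<eta>)"
      using T.packing[OF RT] by (intro mult_left_mono) auto
    also have "\<dots> = 2 powr z / \<eta> * (2 powr (- ((1 - z) * lev T k R)) * (2 powr k R * measure M R))"
      unfolding l by (simp add: powr_add[symmetric] mult.assoc[symmetric] algebra_simps)
    also have "\<dots> \<le> 2 powr z / \<eta> * (2 powr (- ((1 - z) * lev T k R)) * measure N R)"
    proof -
      have "2 powr k R * measure M R \<le> measure N R"
        using k1[OF RT] T.M_pos[OF RT] by (simp add: a_def field_simps)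
      then show ?thesis using \<eta>_pos by (intro mult_left_mono) auto
    qed
    finally show "2 powr (z * (lev T k R + 1)) * (\<Sum>Q\<in>{Q\<in>T. Q \<subseteq> R}. measure M Q)
        \<le> 2 powr z / \<eta> * (2 powr (- ((1 - z) * lev T k R)) * measure N R)" .
  qed
  also have "\<dots> = 2 powr z / \<eta> * (\<Sum>R\<in>P. 2 powr (- ((1 - z) * lev T k R)) * measure N R)"
    by (simp add: sum_distrib_left)
  also have "\<dots> \<le> 2 powr z / \<eta> * (2 powr (- ((1 - z) * k Q0)) / (1 - 2 powr (- (1 - z))) * measure N Q0)"
  proof (intro mult_left_mono sum_powr_level_measure_le)
    show "P \<subseteq> sets N" "Q0 \<in> sets N" using P \<open>T \<subseteq> S\<close> S_sets N Q0 by auto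
    show "emeasure N Q0 < \<infinity>" using N_pos[OF Q0] by (rule emeasure_finite_of_measure_pos)
    show "R \<subseteq> Q0" if "R \<in> P" for R using that P by (auto simp: T_def)
    \<comment> \<open>\<open>Q0\<close> itself belongs to \<open>T\<close>, so it is an ancestor of
      every \<open>R\<close> and bounds all levels from below.\<close>
    show "k Q0 \<le> lev T k R" if "R \<in> P" for R
      using that P Q0T T.finite_S by (intro lev_ge) (auto simp: T_def)
    show "R = R'" if "x \<in> R" "x \<in> R'" "R \<in> P" "R' \<in> P" "lev T k R = lev T k R'" for x R R'
      using stopping_lev_inj[OF T.laminar_S that(1,2)] that(3-5) unfolding P_def by blast
  qed (use z P \<eta>_pos in auto)
  \<comment> \<open>\<open>k Q0\<close> is a floor, and returning to the average of
    \<open>Q0\<close> loses 2^(1-z). Together with the 2^z from rounding the averages up, this is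
    the factor 2 of the claim.\<close>
  also have "\<dots> \<le> 2 powr z / \<eta> * (2 powr (1 - z) * a Q0 powr (- (1 - z)) / (1 - 2 powr (- (1 - z))) * measure N Q0)"
  proof -
    have "(2 powr (k Q0 + 1)) powr (- (1 - z)) \<le> a Q0 powr (- (1 - z))"
      using k2[OF Q0T] apos[OF Q0T] z by (intro powr_mono2') auto
    moreover have "(2 powr (k Q0 + 1)) powr (- (1 - z)) = 2 powr (- ((1 - z) * k Q0)) * 2 powr (- (1 - z))"
      by (simp only: powr_powr powr_add[symmetric]) (simp add: algebra_simps)
    ultimately have "2 powr (- ((1 - z) * k Q0)) \<le> 2 powr (1 - z) * a Q0 powr (- (1 - z))"
      by (simp only: powr_minus[of 2 "1 - z"]) (simp add: field_simps)
    then show ?thesis using \<eta>_pos z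
      by (intro mult_left_mono mult_right_mono divide_right_mono) (auto simp: powr_less_one less_imp_le)
  qed
  also have "\<dots> = 2 / (1 - 2 powr (- (1 - z))) / \<eta> * (a Q0 powr z * measure M Q0)"
  proof -
    have "a Q0 powr (- (1 - z)) * measure N Q0 = a Q0 powr z * measure M Q0"
    proof -
      have "measure N Q0 = a Q0 powr 1 * measure M Q0"
        using M_pos[OF Q0] apos[OF Q0T] by (simp add: a_def)
      then have "a Q0 powr (- (1 - z)) * measure N Q0 = (a Q0 powr (- (1 - z)) * a Q0 powr 1) * measure M Q0"
        by simp
      also have "a Q0 powr (- (1 - z)) * a Q0 powr 1 = a Q0 powr z"
        by (simp only: powr_add[symmetric]) simp
      finally show ?thesis .
    qed
    moreover have "2 powr z * 2 powr (1 - z) = (2::real)" by (simp only: powr_add[symmetric]) simp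
    ultimately show ?thesis by (simp add: field_simps)
  qed
  finally show ?thesis unfolding a_def T_def .
qed

end

subsection \<open>Two weights on a sparse family\<close>

text \<open>\<open>N1\<close>, \<open>N2\<close> are the measures with densities \<sigma>, u;
  \<open>b1\<close>, \<open>b2\<close> are B, A; \<open>P1\<close>, \<open>P2\<close> are 1/p, 1/q'.
  The relation \<sigma>^B u^A = 1 enters only through \<open>E_Holder\<close>. Everything is
  symmetric in the two indices, so each one-sided estimate yields its mirror image.
  \<open>joint\<close> and \<open>lam\<close> are L_Q and \<lambda>_Q.\<close>

locale two_weight_sparse = sparse_laminar M S E \<eta>
  for M :: "'a measure" and S E \<eta> +
  fixes N1 N2 :: "'a measure" and b1 b2 P1 P2 :: real
  assumes sets_N1: "sets N1 = sets M" and sets_N2: "sets N2 = sets M"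
    and N1_pos: "Q \<in> S \<Longrightarrow> 0 < measure N1 Q" and N2_pos: "Q \<in> S \<Longrightarrow> 0 < measure N2 Q"
    and b1_pos: "0 < b1" and b2_pos: "0 < b2"
    and P1: "0 < P1" "P1 < 1" and P2: "0 < P2" "P2 < 1" and P12: "1 \<le> P1 + P2"
    and E_Holder: "Q \<in> S \<Longrightarrow>
      measure M (E Q) powr (b1 + b2) \<le> measure N1 (E Q) powr b1 * measure N2 (E Q) powr b2"
begin

definition joint :: "'a set \<Rightarrow> real" where
  "joint Q = (measure N1 Q / measure M Q) powr b1 * (measure N2 Q / measure M Q) powr b2"

definition lam :: "'a set \<Rightarrow> real" where
  "lam Q = measure N1 Q powr P1 * measure N2 Q powr P2"

lemma swap: "two_weight_sparse M S E \<eta> N2 N1 b2 b1 P2 P1"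
  using sets_N1 sets_N2 N1_pos N2_pos b1_pos b2_pos P1 P2 P12 E_Holder
  by unfold_locales (auto simp: ac_simps)

lemma lam_swap: "two_weight_sparse.lam N2 N1 P2 P1 Q = lam Q"
  unfolding two_weight_sparse.lam_def[OF swap] lam_def by simp

lemma joint_swap: "two_weight_sparse.joint M N2 N1 b2 b1 Q = joint Q"
  unfolding two_weight_sparse.joint_def[OF swap] joint_def by simp

lemma joint_pos: "Q \<in> S \<Longrightarrow> 0 < joint Q"
  using N1_pos N2_pos M_pos by (fastforce simp: joint_def)

lemma lam_nonneg: "0 \<le> lam Q"
  by (simp add: lam_def)

text \<open>A quantitative A_infinity property: Hoelder on \<open>E Q\<close>, with the second
  measure enlarged to all of \<open>Q\<close>, prevents \<open>E Q\<close> from being light for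
  \<open>N1\<close>. Solving for \<open>N1\<close> takes the root 1/b1 of \<open>joint\<close>,
  which is the origin of the term 1/(qB) in \<beta>.\<close>

lemma N1_le_E:
  assumes Q: "Q \<in> S"
  shows "measure N1 Q \<le> (\<eta> powr (- (b1 + b2)) * joint Q) powr (1 / b1) * measure N1 (E Q)"
proof -
  define n where "n = measure N1 Q"
  define n' where "n' = measure N1 (E Q)"
  define u where "u = measure N2 Q"
  define m where "m = measure M Q"
  have pos: "0 < n" "0 < u" "0 < m" "0 \<le> n'"
    using Q N1_pos N2_pos M_pos by (auto simp: n_def u_def m_def n'_def)
  have "Q \<in> sets N2" using Q S_sets sets_N2 by auto
  then have u_E: "measure N2 (E Q) \<le> u"
    unfolding u_def using E_sub[OF Q] E_sets[OF Q] sets_N2 N2_pos[OF Q] by (intro measure_mono_of_pos) auto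
  have "(\<eta> * m) powr (b1 + b2) \<le> measure M (E Q) powr (b1 + b2)"
    using E_large[OF Q] \<eta>_pos pos b1_pos b2_pos unfolding m_def by (intro powr_mono2) auto
  also have "\<dots> \<le> n' powr b1 * measure N2 (E Q) powr b2"
    unfolding n'_def by (rule E_Holder[OF Q])
  also have "\<dots> \<le> n' powr b1 * u powr b2"
    using u_E b2_pos by (intro mult_left_mono powr_mono2) auto
  finally have 1: "\<eta> powr (b1 + b2) * m powr (b1 + b2) \<le> n' powr b1 * u powr b2"
    using \<eta>_pos pos by (simp add: powr_mult)
  have J: "joint Q * m powr (b1 + b2) = n powr b1 * u powr b2"
    unfolding joint_def n_def[symmetric] m_def[symmetric] u_def[symmetric]
    using pos by (simp add: powr_divide powr_add)
  have "n powr b1 * \<eta> powr (b1 + b2) * m powr (b1 + b2) \<le> n powr b1 * (n' powr b1 * u powr b2)"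
    using 1 by (simp add: mult.assoc mult_left_mono)
  also have "\<dots> = n' powr b1 * joint Q * m powr (b1 + b2)"
    using J by (simp add: mult_ac)
  finally have "n powr b1 * \<eta> powr (b1 + b2) \<le> n' powr b1 * joint Q"
    using pos by simp
  then have "n powr b1 \<le> \<eta> powr (- (b1 + b2)) * joint Q * n' powr b1"
    using \<eta>_pos by (simp only: powr_minus[of \<eta> "b1 + b2"]) (simp add: field_simps)
  then have "(n powr b1) powr (1 / b1) \<le> (\<eta> powr (- (b1 + b2)) * joint Q * n' powr b1) powr (1 / b1)"
    using b1_pos by (intro powr_mono2) auto
  also have "\<dots> = (\<eta> powr (- (b1 + b2)) * joint Q) powr (1 / b1) * (n' powr b1) powr (1 / b1)"
    using joint_pos[OF Q] by (intro powr_mult) 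
  finally show ?thesis using pos b1_pos by (simp add: powr_powr n_def n'_def)
qed

text \<open>Where \<open>joint\<close> is essentially constant, \<open>lam\<close> may be multiplied by any power of it; the
  power \<open>- \<delta>\<close> makes the total exponent of the two averages less than one.\<close>

lemma lam_packing:
  fixes \<delta> t :: real
  assumes level: "\<And>Q. Q \<in> S \<Longrightarrow> t \<le> joint Q" "\<And>Q. Q \<in> S \<Longrightarrow> joint Q \<le> 2 * t" and t: "0 < t"
    and \<delta>: "0 < \<delta>" "P1 + P2 - 1 < \<delta> * (b1 + b2)" "\<delta> * b1 < P1" "\<delta> * b2 < P2"
    and Q0: "Q0 \<in> S"
  shows "(\<Sum>Q\<in>{Q\<in>S. Q \<subseteq> Q0}. lam Q)
    \<le> 2 powr \<delta> * (2 / (1 - 2 powr (- (1 - (P1 + P2 - \<delta> * (b1 + b2))))) / \<eta>) * lam Q0"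
proof -
  define x where "x = P1 - \<delta> * b1"
  define y where "y = P2 - \<delta> * b2"
  define z where "z = x + y"
  define e where "e = P1 + P2 - 1"
  define m where "m Q = measure M Q" for Q
  define s where "s Q = measure N1 Q / m Q" for Q
  define u where "u Q = measure N2 Q / m Q" for Q
  define K where "K = 2 / (1 - 2 powr (- (1 - z))) / \<eta>"
  define T where "T = {Q\<in>S. Q \<subseteq> Q0}"
  have zeq: "z = P1 + P2 - \<delta> * (b1 + b2)" by (simp add: z_def x_def y_def algebra_simps)
  \<comment> \<open>The lower bound on \<delta> gives z < 1; its upper bounds keep x and y positive,
    as needed for Hoelder.\<close>
  have xy: "0 < x" "0 < y" "0 < z" "z < 1" "0 \<le> e"
    using \<delta> P12 by (auto simp: x_def y_def z_def e_def algebra_simps)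
  have K: "0 \<le> K" using xy \<eta>_pos by (simp add: K_def powr_less_one less_imp_le)
  have T: "finite T" "T \<subseteq> S" using finite_S by (auto simp: T_def)
  have pos: "0 < m Q" "0 < s Q" "0 < u Q" if "Q \<in> S" for Q
    using that M_pos N1_pos N2_pos by (auto simp: m_def s_def u_def)
  have joint: "joint Q = s Q powr b1 * u Q powr b2" for Q
    by (simp add: joint_def s_def u_def m_def)
  \<comment> \<open>Splitting off the power of \<open>joint\<close> removes \<delta> b1 and \<delta>
    b2 from the exponents of the averages; the volume keeps the surplus power e beyond the
    first.\<close>
  have lam: "lam Q = joint Q powr \<delta> * (s Q powr x * u Q powr y * m Q powr (1 + e))" if "Q \<in> S" for Q
  proof -
    have "lam Q = (s Q * m Q) powr P1 * (u Q * m Q) powr P2"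
      using pos[OF that] by (simp add: lam_def s_def u_def)
    also have "\<dots> = s Q powr (\<delta> * b1 + x) * u Q powr (\<delta> * b2 + y) * m Q powr (P1 + P2)"
      using pos[OF that] by (simp add: powr_mult powr_add x_def y_def)
    also have "\<dots> = (s Q powr b1 * u Q powr b2) powr \<delta> * (s Q powr x * u Q powr y * m Q powr (1 + e))"
      using pos[OF that] by (simp add: powr_mult powr_powr powr_add[of _ _ x] powr_add[of _ _ y] e_def mult_ac)
    finally show ?thesis by (simp add: joint)
  qed
  \<comment> \<open>As e \<ge> 0, that is p \<le> q, the surplus power of the volume is bounded by
    its value at \<open>Q0\<close>.\<close>
  have m_mono: "m Q \<le> m Q0" if "Q \<in> T" for Q
    unfolding m_def using that T S_sets Q0 M_pos[OF Q0] by (intro measure_mono_of_pos) (auto simp: T_def)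
  have "(\<Sum>Q\<in>T. lam Q) \<le> (\<Sum>Q\<in>T. ((2 * t) powr \<delta> * m Q0 powr e) *
      ((s Q powr z * m Q) powr (x / z) * (u Q powr z * m Q) powr (1 - x / z)))"
  proof (rule sum_mono)
    fix Q assume Q: "Q \<in> T"
    then have QS: "Q \<in> S" using T by auto
    have "joint Q powr \<delta> \<le> (2 * t) powr \<delta>"
      using level(2)[OF QS] joint_pos[OF QS] \<delta> by (intro powr_mono2) auto
    moreover have "m Q powr (1 + e) \<le> m Q0 powr e * m Q"
    proof -
      have "m Q powr e \<le> m Q0 powr e" using m_mono[OF Q] pos[OF QS] xy by (intro powr_mono2) auto
      then show ?thesis using pos[OF QS] by (simp add: powr_add mult.commute mult_left_mono)
    qed
    ultimately have "lam Q \<le> (2 * t) powr \<delta> * (s Q powr x * u Q powr y * (m Q0 powr e * m Q))"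
      unfolding lam[OF QS] by (intro mult_mono) auto
    \<comment> \<open>Since x + y = z, Hoelder with weights x/z and y/z gives both factors the same
      exponent z < 1, and the estimate for a single measure applies to each.\<close>
    also have "s Q powr x * u Q powr y * m Q = (s Q powr z * m Q) powr (x / z) * (u Q powr z * m Q) powr (1 - x / z)"
    proof -
      have "1 - x / z = y / z" using xy by (simp add: z_def field_simps)
      moreover have "m Q = m Q powr (x / z) * m Q powr (y / z)"
        using xy pos[OF QS] by (simp add: powr_add[symmetric] add_divide_distrib[symmetric] z_def[symmetric])
      ultimately show ?thesis using xy pos[OF QS] by (simp add: powr_mult powr_powr mult_ac)
    qed
    then have "(2 * t) powr \<delta> * (s Q powr x * u Q powr y * (m Q0 powr e * m Q))
      = ((2 * t) powr \<delta> * m Q0 powr e) * ((s Q powr z * m Q) powr (x / z) * (u Q powr z * m Q) powr (1 - x / z))"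
      by (metis (no_types, opaque_lifting) mult.assoc mult.left_commute)
    finally show "lam Q \<le> ((2 * t) powr \<delta> * m Q0 powr e) *
        ((s Q powr z * m Q) powr (x / z) * (u Q powr z * m Q) powr (1 - x / z))" .
  qed
  also have "\<dots> = ((2 * t) powr \<delta> * m Q0 powr e) *
      (\<Sum>Q\<in>T. (s Q powr z * m Q) powr (x / z) * (u Q powr z * m Q) powr (1 - x / z))"
    by (simp add: sum_distrib_left)
  also have "\<dots> \<le> ((2 * t) powr \<delta> * m Q0 powr e) *
      ((\<Sum>Q\<in>T. s Q powr z * m Q) powr (x / z) * (\<Sum>Q\<in>T. u Q powr z * m Q) powr (1 - x / z))"
    using xy T by (intro mult_left_mono Holder_sum) (auto simp: m_def z_def)
  also have "\<dots> \<le> ((2 * t) powr \<delta> * m Q0 powr e) *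
      ((K * (s Q0 powr z * m Q0)) powr (x / z) * (K * (u Q0 powr z * m Q0)) powr (1 - x / z))"
  proof -
    have s: "(\<Sum>Q\<in>T. s Q powr z * m Q) \<le> K * (s Q0 powr z * m Q0)"
      unfolding s_def m_def K_def T_def using sets_N1 N1_pos xy Q0 by (intro sum_avg_powr_le)
    have u: "(\<Sum>Q\<in>T. u Q powr z * m Q) \<le> K * (u Q0 powr z * m Q0)"
      unfolding u_def m_def K_def T_def using sets_N2 N2_pos xy Q0 by (intro sum_avg_powr_le)
    have nn: "0 \<le> (\<Sum>Q\<in>T. s Q powr z * m Q)" "0 \<le> (\<Sum>Q\<in>T. u Q powr z * m Q)"
      by (auto intro!: sum_nonneg simp: m_def)
    have "0 \<le> 1 - x / z" using xy by (simp add: z_def)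
    then show ?thesis using s u nn xy by (intro mult_left_mono mult_mono powr_mono2) auto
  qed
  also have "\<dots> = (2 * t) powr \<delta> * K * (s Q0 powr x * u Q0 powr y * m Q0 powr (1 + e))"
  proof -
    have 1: "1 - x / z = y / z" using xy by (simp add: z_def field_simps)
    have 2: "K powr (x / z) * K powr (y / z) = K" "m Q0 powr (x / z) * m Q0 powr (y / z) = m Q0"
      using xy pos[OF Q0] K by (cases "K = 0"; simp add: powr_add[symmetric] add_divide_distrib[symmetric] z_def[symmetric])+
    have "(K * (s Q0 powr z * m Q0)) powr (x / z) * (K * (u Q0 powr z * m Q0)) powr (y / z)
       = (K powr (x / z) * K powr (y / z)) * (s Q0 powr x * u Q0 powr y) * (m Q0 powr (x / z) * m Q0 powr (y / z))"
      using K xy pos[OF Q0] by (simp add: powr_mult powr_powr mult_ac)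
    then show ?thesis unfolding 1 2 using pos[OF Q0] by (simp add: powr_add mult_ac)
  qed
  also have "\<dots> \<le> 2 powr \<delta> * K * lam Q0"
  proof -
    \<comment> \<open>The level condition is used both ways: (2t)^\<delta> came from the upper bound
      on \<open>joint\<close>, and the lower bound at \<open>Q0\<close> converts it back.\<close>
    have "(2 * t) powr \<delta> \<le> 2 powr \<delta> * joint Q0 powr \<delta>"
      using level(1)[OF Q0] t \<delta> by (simp add: powr_mult powr_mono2)
    then have "(2 * t) powr \<delta> * (K * (s Q0 powr x * u Q0 powr y * m Q0 powr (1 + e)))
      \<le> (2 powr \<delta> * joint Q0 powr \<delta>) * (K * (s Q0 powr x * u Q0 powr y * m Q0 powr (1 + e)))"
      using K by (intro mult_right_mono) auto
    then show ?thesis unfolding lam[OF Q0] by (simp add: mult_ac)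
  qed
  finally show ?thesis unfolding K_def zeq T_def .
qed

end

section \<open>Levels of averages and their Carleson sums\<close>

definition embed_const :: "real \<Rightarrow> real" where
  "embed_const m = 2 powr m / (1 - 2 powr (- (m - 1)))"

lemma embed_const_nonneg: "1 < m \<Longrightarrow> 0 \<le> embed_const m"
  by (simp add: embed_const_def powr_less_one less_imp_le)

text \<open>For positive \<open>a\<close>, the power 2^dlev is, up to a factor 2, the maximum of
  \<open>a\<close> over the members of \<open>S\<close> containing the given set.\<close>

abbreviation dlev :: "'a set set \<Rightarrow> ('a set \<Rightarrow> real) \<Rightarrow> 'a set \<Rightarrow> int" where
  "dlev S a \<equiv> lev S (\<lambda>Q. \<lfloor>log 2 (a Q)\<rfloor>)"

abbreviation dstop :: "'a set set \<Rightarrow> ('a set \<Rightarrow> real) \<Rightarrow> 'a set set" where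
  "dstop S a \<equiv> stopping S (\<lambda>Q. \<lfloor>log 2 (a Q)\<rfloor>)"

context sparse_laminar
begin

lemma le_dlev:
  assumes "Q \<in> S" "0 < a Q"
  shows "a Q \<le> 2 powr (dlev S a Q + 1)"
proof -
  have "\<lfloor>log 2 (a Q)\<rfloor> \<le> dlev S a Q" using assms finite_S by (intro lev_ge) auto
  then have "log 2 (a Q) \<le> dlev S a Q + 1" by linarith
  then show ?thesis using assms by (simp add: log_le_iff)
qed

text \<open>The free sum: no comparison of N with M takes place over stopping sets, hence no
  constant of the weight appears.\<close>

lemma sum_dstop_le:
  fixes m I :: real
  assumes N: "sets N = sets M" "\<And>Q. Q \<in> S \<Longrightarrow> 0 < measure N Q" and m: "1 < m" and I: "0 \<le> I"
    and \<phi>: "\<phi> \<in> borel_measurable N" "\<And>x. 0 \<le> \<phi> x"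
    and a: "\<And>Q. Q \<in> S \<Longrightarrow> 0 < a Q"
    and avg: "\<And>Q. Q \<in> S \<Longrightarrow> ennreal (a Q) * emeasure N Q \<le> (\<integral>\<^sup>+x\<in>Q. ennreal (\<phi> x) \<partial>N)"
    and int: "(\<integral>\<^sup>+x. ennreal (\<phi> x powr m) \<partial>N) \<le> ennreal I"
  shows "(\<Sum>R\<in>dstop S a. 2 powr (m * dlev S a R) * measure N R) \<le> embed_const m * I"
proof -
  let ?F = "dstop S a"
  have F: "?F \<subseteq> S" by (rule stopping_subset)
  have fin: "emeasure N R < \<infinity>" if "R \<in> S" for R
    using N(2)[OF that] by (rule emeasure_finite_of_measure_pos)
  have "ennreal (\<Sum>R\<in>?F. 2 powr (m * dlev S a R) * measure N R)
      = (\<Sum>R\<in>?F. ennreal (2 powr (m * dlev S a R)) * emeasure N R)"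
  proof (subst sum_ennreal[symmetric])
    show "(\<Sum>R\<in>?F. ennreal (2 powr (m * dlev S a R) * measure N R))
      = (\<Sum>R\<in>?F. ennreal (2 powr (m * dlev S a R)) * emeasure N R)"
      using F N(2) by (intro sum.cong refl) (simp add: ennreal_mult emeasure_finite_of_measure_pos(2) subset_iff)
  qed simp
  also have "\<dots> \<le> ennreal (embed_const m) * (\<integral>\<^sup>+x. ennreal (\<phi> x powr m) \<partial>N)"
    unfolding embed_const_def
  proof (rule carleson_embedding)
    show "finite ?F" using F finite_S by (rule finite_subset)
    show "?F \<subseteq> sets N" using F S_sets N by auto
    show "R = R'" if "x \<in> R" "x \<in> R'" "R \<in> ?F" "R' \<in> ?F" "dlev S a R = dlev S a R'" for x R R'
      using stopping_lev_inj[OF laminar_S that] .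
    show "ennreal (2 powr dlev S a R) * emeasure N R \<le> (\<integral>\<^sup>+x\<in>R. ennreal (\<phi> x) \<partial>N)" if "R \<in> ?F" for R
    proof -
      have R: "R \<in> S" using that F by auto
      have "2 powr dlev S a R \<le> a R"
        unfolding lev_stopping[OF finite_S that] using a[OF R] by (simp add: powr_le_iff)
      then have "ennreal (2 powr dlev S a R) * emeasure N R \<le> ennreal (a R) * emeasure N R"
        by (intro mult_right_mono ennreal_leI) auto
      then show ?thesis using avg[OF R] by (rule order_trans)
    qed
  qed (use m \<phi> F fin in auto)
  also have "\<dots> \<le> ennreal (embed_const m) * ennreal I"
    using int by (rule mult_left_mono) simp
  also have "\<dots> = ennreal (embed_const m * I)"
    using I embed_const_nonneg[OF m] by (simp add: ennreal_mult)
  finally show ?thesis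
    using I embed_const_nonneg[OF m] by (subst (asm) ennreal_le_iff) auto
qed

text \<open>The supremum bound for the interpolation in \<open>half_sum_le\<close>. The stopping
  parent has the same level and at least the same measure, so its single term already
  dominates.\<close>

lemma dlev_term_le:
  fixes W m :: real
  assumes W: "(\<Sum>R\<in>dstop S a. 2 powr (m * dlev S a R) * measure N R) \<le> W"
    and N: "sets N = sets M" "\<And>Q. Q \<in> S \<Longrightarrow> 0 < measure N Q" and Q: "Q \<in> S"
  shows "2 powr (m * dlev S a Q) * measure N Q \<le> W"
proof -
  obtain R where R: "R \<in> dstop S a" "Q \<subseteq> R" "dlev S a R = dlev S a Q"
    using stopping_parent[OF finite_S Q] by metis
  have RS: "R \<in> S" using R stopping_subset by blast
  have "measure N Q \<le> measure N R"
    using S_sets Q RS N(1) R(2) N(2)[OF RS] by (intro measure_mono_of_pos) auto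
  then have "2 powr (m * dlev S a Q) * measure N Q \<le> 2 powr (m * dlev S a R) * measure N R"
    using R by (simp add: mult_left_mono)
  also have "\<dots> \<le> (\<Sum>R\<in>dstop S a. 2 powr (m * dlev S a R) * measure N R)"
    using R finite_subset[OF stopping_subset finite_S] by (intro member_le_sum) auto
  finally show ?thesis using W by simp
qed

text \<open>The step from stopping sets to all sets is where the weight is paid for:
  \<open>B\<close> replaces each measure by that of \<open>E Q\<close>, and these disjoint sets pack
  inside every stopping set.\<close>

lemma sum_dlev_le:
  fixes W m :: real
  assumes W: "(\<Sum>R\<in>dstop S a. 2 powr (m * dlev S a R) * measure N R) \<le> W"
    and N: "sets N = sets M" "\<And>Q. Q \<in> S \<Longrightarrow> 0 < measure N Q"
    and B: "\<And>Q. Q \<in> S \<Longrightarrow> measure N Q \<le> B * measure N (E Q)" "0 \<le> B"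
  shows "(\<Sum>Q\<in>S. 2 powr (m * dlev S a Q) * measure N Q) \<le> B * W"
proof -
  let ?F = "dstop S a"
  have F: "?F \<subseteq> S" by (rule stopping_subset)
  have "(\<Sum>Q\<in>S. 2 powr (m * dlev S a Q) * measure N Q)
     \<le> (\<Sum>R\<in>?F. 2 powr (m * dlev S a R) * (\<Sum>Q\<in>{Q\<in>S. Q \<subseteq> R}. measure N Q))"
  proof (rule sum_le_sum_cover[where a="\<lambda>Q. 2 powr (m * dlev S a Q)"])
    fix Q assume "Q \<in> S"
    then obtain R where "R \<in> ?F" "Q \<subseteq> R" "dlev S a R = dlev S a Q"
      using stopping_parent[OF finite_S] by metis
    then show "\<exists>R\<in>?F. Q \<subseteq> R \<and> 2 powr (m * dlev S a Q) \<le> 2 powr (m * dlev S a R)" by auto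
  qed (use finite_S finite_subset[OF F finite_S] in auto)
  also have "\<dots> \<le> (\<Sum>R\<in>?F. B * (2 powr (m * dlev S a R) * measure N R))"
  proof (rule sum_mono)
    fix R assume "R \<in> ?F"
    then have R: "R \<in> S" using F by auto
    have "(\<Sum>Q\<in>{Q\<in>S. Q \<subseteq> R}. measure N Q) \<le> B * (\<Sum>Q\<in>{Q\<in>S. Q \<subseteq> R}. measure N (E Q))"
      unfolding sum_distrib_left using B by (intro sum_mono) auto
    also have "\<dots> \<le> B * measure N R"
      using R N B by (intro mult_left_mono sum_E_le) auto
    finally show "2 powr (m * dlev S a R) * (\<Sum>Q\<in>{Q\<in>S. Q \<subseteq> R}. measure N Q)
        \<le> B * (2 powr (m * dlev S a R) * measure N R)"
      by (simp add: mult_left_mono mult.left_commute)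
  qed
  also have "\<dots> \<le> B * W" using W B by (simp add: sum_distrib_left[symmetric] mult_left_mono)
  finally show ?thesis .
qed

end

context two_weight_sparse
begin

text \<open>The exponents \<open>1 - P2\<close> and \<open>P2\<close> (instead of \<open>P1\<close> and \<open>1 - P1\<close>) are what makes the
  packing constant \<open>B\<close> enter with the sharp power; this uses \<open>P1 + P2 \<ge> 1\<close>.\<close>

lemma half_sum_le:
  fixes l1 l2 :: "'a set \<Rightarrow> real"
  assumes T: "T \<subseteq> S" and B: "0 \<le> B" and W: "0 \<le> W1" "0 \<le> W2"
    and term1: "\<And>Q. Q \<in> S \<Longrightarrow> 2 powr ((P1 + b1) / P1 * l1 Q) * measure N1 Q \<le> W1"
    and sum1: "(\<Sum>Q\<in>S. 2 powr ((P1 + b1) / P1 * l1 Q) * measure N1 Q) \<le> B * W1"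
    and sum2: "(\<Sum>Q\<in>T. 2 powr ((P2 + b2) / P2 * l2 Q) * measure N2 Q) \<le> W2"
  shows "(\<Sum>Q\<in>T. 2 powr ((P1 + b1) * l1 Q) * 2 powr ((P2 + b2) * l2 Q) * lam Q)
     \<le> B powr (1 - P2) * W1 powr P1 * W2 powr P2"
proof -
  define V1 where "V1 Q = 2 powr ((P1 + b1) / P1 * l1 Q) * measure N1 Q" for Q
  define V2 where "V2 Q = 2 powr ((P2 + b2) / P2 * l2 Q) * measure N2 Q" for Q
  \<comment> \<open>This is q/p. Hoelder leaves \<open>V1\<close> the exponent 1 - P2, and the
    surplus of P1 over it is absorbed by the supremum bound \<open>W1\<close>.\<close>
  define \<kappa> where "\<kappa> = P1 / (1 - P2)"
  have \<kappa>: "1 \<le> \<kappa>" using P12 P2 by (simp add: \<kappa>_def field_simps)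
  have nn: "0 \<le> V1 Q" "0 \<le> V2 Q" for Q by (auto simp: V1_def V2_def)
  have "finite T" using T finite_S finite_subset by blast
  have "(\<Sum>Q\<in>T. 2 powr ((P1 + b1) * l1 Q) * 2 powr ((P2 + b2) * l2 Q) * lam Q)
      = (\<Sum>Q\<in>T. (V1 Q powr \<kappa>) powr (1 - P2) * V2 Q powr (1 - (1 - P2)))"
  proof (intro sum.cong refl)
    fix Q
    have "\<kappa> * (1 - P2) = P1" using P2 by (simp add: \<kappa>_def)
    then have "(V1 Q powr \<kappa>) powr (1 - P2) * V2 Q powr (1 - (1 - P2)) = V1 Q powr P1 * V2 Q powr P2"
      by (simp add: powr_powr)
    also have "\<dots> = 2 powr ((P1 + b1) * l1 Q) * 2 powr ((P2 + b2) * l2 Q) * lam Q"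
      using P1 P2 by (simp add: V1_def V2_def lam_def powr_mult powr_powr mult_ac)
    finally show "2 powr ((P1 + b1) * l1 Q) * 2 powr ((P2 + b2) * l2 Q) * lam Q
      = (V1 Q powr \<kappa>) powr (1 - P2) * V2 Q powr (1 - (1 - P2))" by simp
  qed
  also have "\<dots> \<le> (\<Sum>Q\<in>T. V1 Q powr \<kappa>) powr (1 - P2) * (\<Sum>Q\<in>T. V2 Q) powr (1 - (1 - P2))"
    using P2 nn \<open>finite T\<close> by (intro Holder_sum) auto
  also have "\<dots> \<le> (B * W1 powr \<kappa>) powr (1 - P2) * W2 powr P2"
  proof -
    have "(\<Sum>Q\<in>T. V1 Q powr \<kappa>) \<le> (\<Sum>Q\<in>S. V1 Q powr \<kappa>)"
      using T finite_S by (intro sum_mono2) auto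
    also have "\<dots> \<le> (\<Sum>Q\<in>S. W1 powr (\<kappa> - 1) * V1 Q)"
      using term1 nn \<kappa> by (intro sum_mono powr_le_self_scaled) (auto simp: V1_def)
    also have "\<dots> \<le> W1 powr (\<kappa> - 1) * (B * W1)"
      unfolding sum_distrib_left[symmetric] using sum1 by (intro mult_left_mono) (auto simp: V1_def)
    also have "\<dots> = B * W1 powr \<kappa>" using W by (cases "W1 = 0") (auto simp: powr_diff)
    finally have 1: "(\<Sum>Q\<in>T. V1 Q powr \<kappa>) \<le> B * W1 powr \<kappa>" .
    have 2: "(\<Sum>Q\<in>T. V2 Q) \<le> W2" using sum2 by (simp add: V2_def)
    have "0 \<le> (\<Sum>Q\<in>T. V1 Q powr \<kappa>)" "0 \<le> (\<Sum>Q\<in>T. V2 Q)"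
      using nn by (auto intro!: sum_nonneg)
    moreover have "1 - (1 - P2) = P2" by simp
    ultimately show ?thesis using 1 2 P2 by (simp only:) (intro mult_mono powr_mono2; simp)
  qed
  also have "\<dots> = B powr (1 - P2) * W1 powr P1 * W2 powr P2"
  proof -
    have "\<kappa> * (1 - P2) = P1" using P2 by (simp add: \<kappa>_def)
    then show ?thesis using B W by (simp add: powr_mult powr_powr)
  qed
  finally show ?thesis .
qed

text \<open>Parallel stopping: the two stopping parents of a set meet, hence are nested. The level
  of the larger parent equals that of \<open>Q\<close>, and by monotonicity the smaller parent,
  lying between them, shares both levels with \<open>Q\<close>. So \<open>Q\<close> may be charged
  there.\<close>

lemma sum_reduce_to_stopping:
  assumes a1: "\<And>Q. Q \<in> S \<Longrightarrow> 0 < a1 Q" and a2: "\<And>Q. Q \<in> S \<Longrightarrow> 0 < a2 Q"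
    and C: "\<And>R. R \<in> S \<Longrightarrow> (\<Sum>Q\<in>{Q\<in>S. Q \<subseteq> R}. lam Q) \<le> C * lam R" "0 \<le> C"
  shows "(\<Sum>Q\<in>S. a1 Q powr (P1 + b1) * a2 Q powr (P2 + b2) * lam Q)
     \<le> 2 powr (P1 + b1 + P2 + b2) * C *
       ((\<Sum>Q\<in>dstop S a1. 2 powr ((P1 + b1) * dlev S a1 Q) * 2 powr ((P2 + b2) * dlev S a2 Q) * lam Q)
      + (\<Sum>Q\<in>dstop S a2. 2 powr ((P1 + b1) * dlev S a1 Q) * 2 powr ((P2 + b2) * dlev S a2 Q) * lam Q))"
proof -
  let ?F1 = "dstop S a1" and ?F2 = "dstop S a2"
  define w where "w Q = 2 powr ((P1 + b1) * dlev S a1 Q) * 2 powr ((P2 + b2) * dlev S a2 Q)" for Q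
  define A where "A = 2 powr (P1 + b1 + P2 + b2)"
  have F: "?F1 \<subseteq> S" "?F2 \<subseteq> S" "finite ?F1" "finite ?F2"
    using stopping_subset finite_subset[OF stopping_subset finite_S] by blast+
  have "(\<Sum>Q\<in>S. a1 Q powr (P1 + b1) * a2 Q powr (P2 + b2) * lam Q)
     \<le> (\<Sum>R\<in>?F1 \<union> ?F2. (A * w R) * (\<Sum>Q\<in>{Q\<in>S. Q \<subseteq> R}. lam Q))"
  proof (rule sum_le_sum_cover[where a="\<lambda>Q. a1 Q powr (P1 + b1) * a2 Q powr (P2 + b2)"])
    fix Q assume Q: "Q \<in> S"
    have "0 \<le> P1 + b1" "0 \<le> P2 + b2" using P1 P2 b1_pos b2_pos by auto
    then have "a1 Q powr (P1 + b1) \<le> (2 powr (dlev S a1 Q + 1)) powr (P1 + b1)"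
      "a2 Q powr (P2 + b2) \<le> (2 powr (dlev S a2 Q + 1)) powr (P2 + b2)"
      using le_dlev[of Q a1, OF Q a1[OF Q]] le_dlev[of Q a2, OF Q a2[OF Q]] a1[OF Q] a2[OF Q]
      by (simp_all only: powr_mono2 less_imp_le)
    then have "a1 Q powr (P1 + b1) * a2 Q powr (P2 + b2)
        \<le> (2 powr (dlev S a1 Q + 1)) powr (P1 + b1) * (2 powr (dlev S a2 Q + 1)) powr (P2 + b2)"
      by (intro mult_mono) simp_all
    also have "\<dots> = A * w Q"
      unfolding A_def w_def powr_powr powr_add[symmetric] by (simp add: algebra_simps)
    finally have le: "a1 Q powr (P1 + b1) * a2 Q powr (P2 + b2) \<le> A * w Q" .
    obtain R1 where R1: "R1 \<in> ?F1" "Q \<subseteq> R1" "dlev S a1 R1 = dlev S a1 Q"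
      using stopping_parent[OF finite_S Q] by metis
    obtain R2 where R2: "R2 \<in> ?F2" "Q \<subseteq> R2" "dlev S a2 R2 = dlev S a2 Q"
      using stopping_parent[OF finite_S Q] by metis
    have RS: "R1 \<in> S" "R2 \<in> S" using F R1(1) R2(1) by auto
    have "Q \<noteq> {}" using M_pos[OF Q] by auto
    then have "R1 \<inter> R2 \<noteq> {}" using R1(2) R2(2) by blast
    then have "R1 \<subseteq> R2 \<or> R2 \<subseteq> R1"
      using laminar_S RS unfolding laminar_def by blast
    then show "\<exists>R\<in>?F1 \<union> ?F2. Q \<subseteq> R \<and> a1 Q powr (P1 + b1) * a2 Q powr (P2 + b2) \<le> A * w R"
    proof
      assume "R1 \<subseteq> R2"
      then have "dlev S a2 R2 \<le> dlev S a2 R1" "dlev S a2 R1 \<le> dlev S a2 Q"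
        using RS R1(2) R2(2) finite_S by (simp_all add: lev_antimono)
      then have "dlev S a2 R1 = dlev S a2 Q" using R2 by simp
      then have "w R1 = w Q" using R1 by (simp add: w_def)
      then show ?thesis using le R1 by auto
    next
      assume "R2 \<subseteq> R1"
      then have "dlev S a1 R1 \<le> dlev S a1 R2" "dlev S a1 R2 \<le> dlev S a1 Q"
        using RS R1(2) R2(2) finite_S by (simp_all add: lev_antimono)
      then have "dlev S a1 R2 = dlev S a1 Q" using R1 by simp
      then have "w R2 = w Q" using R2 by (simp add: w_def)
      then show ?thesis using le R2 by auto
    qed
  qed (use finite_S F lam_nonneg in \<open>auto simp: A_def w_def\<close>)
  also have "\<dots> \<le> (\<Sum>R\<in>?F1 \<union> ?F2. A * C * (w R * lam R))"
  proof (rule sum_mono)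
    fix R assume "R \<in> ?F1 \<union> ?F2"
    then have "R \<in> S" using F by auto
    then have "A * w R * (\<Sum>Q\<in>{Q\<in>S. Q \<subseteq> R}. lam Q) \<le> A * w R * (C * lam R)"
      using C by (intro mult_left_mono) (auto simp: A_def w_def)
    then show "A * w R * (\<Sum>Q\<in>{Q\<in>S. Q \<subseteq> R}. lam Q) \<le> A * C * (w R * lam R)"
      by (simp add: mult_ac)
  qed
  also have "\<dots> = A * C * (\<Sum>R\<in>?F1 \<union> ?F2. w R * lam R)" by (simp add: sum_distrib_left)
  also have "\<dots> \<le> A * C * ((\<Sum>R\<in>?F1. w R * lam R) + (\<Sum>R\<in>?F2. w R * lam R))"
  proof -
    have "0 \<le> (\<Sum>R\<in>?F1 \<inter> ?F2. w R * lam R)"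
      by (intro sum_nonneg) (auto simp: w_def lam_nonneg)
    then have "(\<Sum>R\<in>?F1 \<union> ?F2. w R * lam R) \<le> (\<Sum>R\<in>?F1. w R * lam R) + (\<Sum>R\<in>?F2. w R * lam R)"
      using sum.union_inter[OF F(3,4), of "\<lambda>R. w R * lam R"] by linarith
    then show ?thesis using C by (intro mult_left_mono) (auto simp: A_def)
  qed
  finally show ?thesis by (simp add: A_def w_def)
qed

end

section \<open>Constants, one level of \<open>joint\<close>, and the sum over levels\<close>

definition carleson_const :: "real \<Rightarrow> real \<Rightarrow> real \<Rightarrow> real \<Rightarrow> real \<Rightarrow> real \<Rightarrow> real" where
  "carleson_const \<eta> b1 b2 P1 P2 \<delta> = 2 powr \<delta> * (2 / (1 - 2 powr (- (1 - (P1 + P2 - \<delta> * (b1 + b2))))) / \<eta>)"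

text \<open>In order: rounding of the averages, packing of \<open>lam\<close>, the two embeddings,
  and the comparison of \<open>Q\<close> with \<open>E Q\<close> in either half. Only exponents and
  \<eta> occur, so the constant can be fixed before the weight and the functions.\<close>

definition core_const :: "real \<Rightarrow> real \<Rightarrow> real \<Rightarrow> real \<Rightarrow> real \<Rightarrow> real \<Rightarrow> real" where
  "core_const \<eta> b1 b2 P1 P2 \<delta> = 2 powr (P1 + b1 + P2 + b2) * carleson_const \<eta> b1 b2 P1 P2 \<delta> *
     (embed_const ((P1 + b1) / P1) powr P1 * embed_const ((P2 + b2) / P2) powr P2) *
     ((2 * \<eta> powr (- (b1 + b2))) powr ((1 - P2) / b1) + (2 * \<eta> powr (- (b1 + b2))) powr ((1 - P1) / b2))"

lemma carleson_const_nonneg: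
  "0 < \<eta> \<Longrightarrow> P1 + P2 - 1 < \<delta> * (b1 + b2) \<Longrightarrow> 0 \<le> carleson_const \<eta> b1 b2 P1 P2 \<delta>"
  by (simp add: carleson_const_def powr_less_one less_imp_le)

lemma core_const_nonneg:
  "0 < \<eta> \<Longrightarrow> P1 + P2 - 1 < \<delta> * (b1 + b2) \<Longrightarrow> 0 \<le> core_const \<eta> b1 b2 P1 P2 \<delta>"
  by (simp add: core_const_def carleson_const_nonneg)

context two_weight_sparse
begin

lemma N1_le_E_level:
  assumes Q: "Q \<in> S" and le: "joint Q \<le> 2 * t"
  shows "measure N1 Q \<le> ((2 * \<eta> powr (- (b1 + b2))) * t) powr (1 / b1) * measure N1 (E Q)"
proof -
  have "(\<eta> powr (- (b1 + b2)) * joint Q) powr (1 / b1) \<le> ((2 * \<eta> powr (- (b1 + b2))) * t) powr (1 / b1)"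
  proof (rule powr_mono2)
    have "\<eta> powr (- (b1 + b2)) * joint Q \<le> \<eta> powr (- (b1 + b2)) * (2 * t)"
      using le by (rule mult_left_mono) simp
    then show "\<eta> powr (- (b1 + b2)) * joint Q \<le> (2 * \<eta> powr (- (b1 + b2))) * t"
      by (simp only: mult_ac)
  qed (use joint_pos[OF Q] b1_pos in auto)
  then have "(\<eta> powr (- (b1 + b2)) * joint Q) powr (1 / b1) * measure N1 (E Q)
      \<le> ((2 * \<eta> powr (- (b1 + b2))) * t) powr (1 / b1) * measure N1 (E Q)"
    by (rule mult_right_mono) simp
  with N1_le_E[OF Q] show ?thesis by linarith
qed

text \<open>The two powers of t are the prices of the two halves: on the stopping sets of
  \<open>a2\<close> the measure \<open>N1\<close> pays, on those of \<open>a1\<close> the measure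
  \<open>N2\<close>, by the mirrored locale.\<close>

lemma level_sum_le:
  fixes \<delta> t I1 I2 :: real
  assumes level: "\<And>Q. Q \<in> S \<Longrightarrow> t \<le> joint Q" "\<And>Q. Q \<in> S \<Longrightarrow> joint Q \<le> 2 * t" and t: "0 < t"
    and \<delta>: "0 < \<delta>" "P1 + P2 - 1 < \<delta> * (b1 + b2)" "\<delta> * b1 < P1" "\<delta> * b2 < P2"
    and I: "0 \<le> I1" "0 \<le> I2"
    and \<phi>: "\<phi> \<in> borel_measurable N1" "\<And>x. 0 \<le> \<phi> x"
    and a1: "\<And>Q. Q \<in> S \<Longrightarrow> 0 < a1 Q"
      "\<And>Q. Q \<in> S \<Longrightarrow> ennreal (a1 Q) * emeasure N1 Q \<le> (\<integral>\<^sup>+x\<in>Q. ennreal (\<phi> x) \<partial>N1)"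
    and I1: "(\<integral>\<^sup>+x. ennreal (\<phi> x powr ((P1 + b1) / P1)) \<partial>N1) \<le> ennreal I1"
    and \<psi>: "\<psi> \<in> borel_measurable N2" "\<And>x. 0 \<le> \<psi> x"
    and a2: "\<And>Q. Q \<in> S \<Longrightarrow> 0 < a2 Q"
      "\<And>Q. Q \<in> S \<Longrightarrow> ennreal (a2 Q) * emeasure N2 Q \<le> (\<integral>\<^sup>+x\<in>Q. ennreal (\<psi> x) \<partial>N2)"
    and I2: "(\<integral>\<^sup>+x. ennreal (\<psi> x powr ((P2 + b2) / P2)) \<partial>N2) \<le> ennreal I2"
  shows "(\<Sum>Q\<in>S. a1 Q powr (P1 + b1) * a2 Q powr (P2 + b2) * lam Q)
     \<le> core_const \<eta> b1 b2 P1 P2 \<delta> * (I1 powr P1 * I2 powr P2) *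
       (t powr ((1 - P2) / b1) + t powr ((1 - P1) / b2))"
proof -
  interpret sw: two_weight_sparse M S E \<eta> N2 N1 b2 b1 P2 P1 by (rule swap)
  define D1 where "D1 = embed_const ((P1 + b1) / P1)"
  define D2 where "D2 = embed_const ((P2 + b2) / P2)"
  define h where "h = 2 * \<eta> powr (- (b1 + b2))"
  define g1 where "g1 = (1 - P2) / b1"
  define g2 where "g2 = (1 - P1) / b2"
  define C where "C = carleson_const \<eta> b1 b2 P1 P2 \<delta>"
  define l1 where "l1 Q = real_of_int (dlev S a1 Q)" for Q
  define l2 where "l2 Q = real_of_int (dlev S a2 Q)" for Q
  have m: "1 < (P1 + b1) / P1" "1 < (P2 + b2) / P2"
    using P1 P2 b1_pos b2_pos by (auto simp: field_simps)
  have D: "0 \<le> D1" "0 \<le> D2" using embed_const_nonneg m by (auto simp: D1_def D2_def)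
  have h: "0 < h" using \<eta>_pos by (simp add: h_def)
  have C: "0 \<le> C" unfolding C_def by (rule carleson_const_nonneg) (use \<eta>_pos \<delta> in auto)
  have B1: "measure N1 Q \<le> (h * t) powr (1 / b1) * measure N1 (E Q)" if "Q \<in> S" for Q
    unfolding h_def using that level(2) by (intro N1_le_E_level)
  have B2: "measure N2 Q \<le> (h * t) powr (1 / b2) * measure N2 (E Q)" if "Q \<in> S" for Q
    using sw.N1_le_E_level[OF that, of t] level(2)[OF that] by (simp add: joint_swap h_def add.commute)
  have st1: "(\<Sum>R\<in>dstop S a1. 2 powr ((P1 + b1) / P1 * l1 R) * measure N1 R) \<le> D1 * I1"
    unfolding D1_def l1_def using sets_N1 N1_pos m I \<phi> a1 I1 by (intro sum_dstop_le) 
  have st2: "(\<Sum>R\<in>dstop S a2. 2 powr ((P2 + b2) / P2 * l2 R) * measure N2 R) \<le> D2 * I2"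
    unfolding D2_def l2_def using sets_N2 N2_pos m I \<psi> a2 I2 by (intro sum_dstop_le) 
  have half1: "(\<Sum>Q\<in>dstop S a2. 2 powr ((P1 + b1) * l1 Q) * 2 powr ((P2 + b2) * l2 Q) * lam Q)
      \<le> ((h * t) powr (1 / b1)) powr (1 - P2) * (D1 * I1) powr P1 * (D2 * I2) powr P2"
  proof (rule half_sum_le)
    show "2 powr ((P1 + b1) / P1 * l1 Q) * measure N1 Q \<le> D1 * I1" if "Q \<in> S" for Q
      using dlev_term_le[OF st1[unfolded l1_def] sets_N1 N1_pos that] by (simp add: l1_def)
    show "(\<Sum>Q\<in>S. 2 powr ((P1 + b1) / P1 * l1 Q) * measure N1 Q) \<le> (h * t) powr (1 / b1) * (D1 * I1)"
      unfolding l1_def using st1 sets_N1 N1_pos B1 by (intro sum_dlev_le) (auto simp: l1_def)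
  qed (use st2 stopping_subset D I in auto)
  have half2: "(\<Sum>Q\<in>dstop S a1. 2 powr ((P2 + b2) * l2 Q) * 2 powr ((P1 + b1) * l1 Q) * sw.lam Q)
      \<le> ((h * t) powr (1 / b2)) powr (1 - P1) * (D2 * I2) powr P2 * (D1 * I1) powr P1"
  proof (rule sw.half_sum_le)
    show "2 powr ((P2 + b2) / P2 * l2 Q) * measure N2 Q \<le> D2 * I2" if "Q \<in> S" for Q
      using dlev_term_le[OF st2[unfolded l2_def] sets_N2 N2_pos that] by (simp add: l2_def)
    show "(\<Sum>Q\<in>S. 2 powr ((P2 + b2) / P2 * l2 Q) * measure N2 Q) \<le> (h * t) powr (1 / b2) * (D2 * I2)"
      unfolding l2_def using st2 sets_N2 N2_pos B2 by (intro sum_dlev_le) (auto simp: l2_def)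
  qed (use st1 stopping_subset D I in auto)
  define J where "J = (D1 powr P1 * D2 powr P2) * (I1 powr P1 * I2 powr P2)"
  have J: "0 \<le> J" by (simp add: J_def)
  have half1': "(\<Sum>Q\<in>dstop S a2. 2 powr ((P1 + b1) * l1 Q) * 2 powr ((P2 + b2) * l2 Q) * lam Q)
      \<le> h powr g1 * t powr g1 * J"
    using half1 h t D I by (simp add: J_def g1_def powr_mult powr_powr mult_ac)
  have half2': "(\<Sum>Q\<in>dstop S a1. 2 powr ((P1 + b1) * l1 Q) * 2 powr ((P2 + b2) * l2 Q) * lam Q)
      \<le> h powr g2 * t powr g2 * J"
    using half2 h t D I by (simp add: J_def g2_def powr_mult powr_powr mult_ac lam_swap)
  have "(\<Sum>Q\<in>S. a1 Q powr (P1 + b1) * a2 Q powr (P2 + b2) * lam Q)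
     \<le> 2 powr (P1 + b1 + P2 + b2) * C *
       ((\<Sum>Q\<in>dstop S a1. 2 powr ((P1 + b1) * l1 Q) * 2 powr ((P2 + b2) * l2 Q) * lam Q)
      + (\<Sum>Q\<in>dstop S a2. 2 powr ((P1 + b1) * l1 Q) * 2 powr ((P2 + b2) * l2 Q) * lam Q))"
    unfolding l1_def l2_def
  proof (rule sum_reduce_to_stopping)
    show "(\<Sum>Q\<in>{Q\<in>S. Q \<subseteq> R}. lam Q) \<le> C * lam R" if "R \<in> S" for R
      unfolding C_def carleson_const_def using level t \<delta> that by (intro lam_packing)
  qed (use a1 a2 C in auto)
  also have "\<dots> \<le> 2 powr (P1 + b1 + P2 + b2) * C * (h powr g2 * t powr g2 * J + h powr g1 * t powr g1 * J)"
    using half1' half2' C by (intro mult_left_mono add_mono) auto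
  \<comment> \<open>Adding the nonnegative cross terms separates the constant from the powers of
    t.\<close>
  also have "\<dots> \<le> 2 powr (P1 + b1 + P2 + b2) * C * ((h powr g1 + h powr g2) * (t powr g1 + t powr g2) * J)"
  proof (intro mult_left_mono)
    have "h powr g2 * t powr g2 + h powr g1 * t powr g1 \<le> (h powr g1 + h powr g2) * (t powr g1 + t powr g2)"
      by (simp add: algebra_simps)
    then have "(h powr g2 * t powr g2 + h powr g1 * t powr g1) * J \<le> (h powr g1 + h powr g2) * (t powr g1 + t powr g2) * J"
      using J by (rule mult_right_mono)
    then show "h powr g2 * t powr g2 * J + h powr g1 * t powr g1 * J \<le> (h powr g1 + h powr g2) * (t powr g1 + t powr g2) * J"
      by (simp add: algebra_simps)
  qed (use C in auto)
  also have "\<dots> = core_const \<eta> b1 b2 P1 P2 \<delta> * (I1 powr P1 * I2 powr P2) * (t powr g1 + t powr g2)"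
    by (simp add: core_const_def C_def J_def D1_def D2_def h_def g1_def g2_def)
  finally show ?thesis by (simp add: g1_def g2_def)
qed

lemma sub_family2:
  assumes "T \<subseteq> S"
  shows "two_weight_sparse M T E \<eta> N1 N2 b1 b2 P1 P2"
proof -
  interpret T: sparse_laminar M T E \<eta> using assms by (rule sub_family)
  show ?thesis
    using assms sets_N1 sets_N2 N1_pos N2_pos b1_pos b2_pos P1 P2 P12 E_Holder
    by unfold_locales (simp_all add: subset_iff)
qed

text \<open>With the factor \<open>joint\<close> included, a level contributes a positive power 1 +
  g of 2^j, so the top level dominates and no count of levels is lost. The constant 8 is 2 for
  rounding \<open>joint\<close>, 2 for the geometric series, and 2 for replacing both g1 and g2 by
  their maximum, which uses L \<ge> 1.\<close>

theorem sparse_form_le: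
  fixes \<delta> L I1 I2 :: real
  assumes L: "\<And>Q. Q \<in> S \<Longrightarrow> joint Q \<le> L" "1 \<le> L"
    and \<delta>: "0 < \<delta>" "P1 + P2 - 1 < \<delta> * (b1 + b2)" "\<delta> * b1 < P1" "\<delta> * b2 < P2"
    and I: "0 \<le> I1" "0 \<le> I2"
    and \<phi>: "\<phi> \<in> borel_measurable N1" "\<And>x. 0 \<le> \<phi> x"
    and a1: "\<And>Q. Q \<in> S \<Longrightarrow> 0 < a1 Q"
      "\<And>Q. Q \<in> S \<Longrightarrow> ennreal (a1 Q) * emeasure N1 Q \<le> (\<integral>\<^sup>+x\<in>Q. ennreal (\<phi> x) \<partial>N1)"
    and I1: "(\<integral>\<^sup>+x. ennreal (\<phi> x powr ((P1 + b1) / P1)) \<partial>N1) \<le> ennreal I1"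
    and \<psi>: "\<psi> \<in> borel_measurable N2" "\<And>x. 0 \<le> \<psi> x"
    and a2: "\<And>Q. Q \<in> S \<Longrightarrow> 0 < a2 Q"
      "\<And>Q. Q \<in> S \<Longrightarrow> ennreal (a2 Q) * emeasure N2 Q \<le> (\<integral>\<^sup>+x\<in>Q. ennreal (\<psi> x) \<partial>N2)"
    and I2: "(\<integral>\<^sup>+x. ennreal (\<psi> x powr ((P2 + b2) / P2)) \<partial>N2) \<le> ennreal I2"
  shows "(\<Sum>Q\<in>S. a1 Q powr (P1 + b1) * a2 Q powr (P2 + b2) * (joint Q * lam Q))
     \<le> 8 * core_const \<eta> b1 b2 P1 P2 \<delta> * L powr (1 + max ((1 - P2) / b1) ((1 - P1) / b2)) *
       (I1 powr P1 * I2 powr P2)"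
proof -
  define g1 where "g1 = (1 - P2) / b1"
  define g2 where "g2 = (1 - P1) / b2"
  define K where "K = core_const \<eta> b1 b2 P1 P2 \<delta> * (I1 powr P1 * I2 powr P2)"
  define k where "k Q = \<lfloor>log 2 (joint Q)\<rfloor>" for Q
  define X where "X Q = a1 Q powr (P1 + b1) * a2 Q powr (P2 + b2) * lam Q" for Q
  have g: "0 \<le> g1" "0 \<le> g2" using P1 P2 b1_pos b2_pos by (auto simp: g1_def g2_def)
  have K: "0 \<le> K" unfolding K_def using core_const_nonneg[OF \<eta>_pos \<delta>(2)] by simp
  have X: "0 \<le> X Q" for Q by (simp add: X_def lam_nonneg)
  have k1: "2 powr k Q \<le> joint Q" if "Q \<in> S" for Q
    using joint_pos[OF that] by (simp add: k_def powr_le_iff)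
  have k2: "joint Q \<le> 2 * 2 powr k Q" if "Q \<in> S" for Q
  proof -
    have "log 2 (joint Q) \<le> k Q + 1" unfolding k_def by linarith
    then have "joint Q \<le> 2 powr (k Q + 1)" using joint_pos[OF that] by (simp add: log_le_iff)
    then show ?thesis by (simp add: powr_add)
  qed
  have lev: "(\<Sum>Q\<in>{Q\<in>S. k Q = j}. joint Q * X Q) \<le> 2 * K * (2 powr ((1 + g1) * j) + 2 powr ((1 + g2) * j))" for j
  proof -
    let ?T = "{Q\<in>S. k Q = j}"
    \<comment> \<open>Stopping sets are formed inside the level family, so the level bounds hold for
      all of them.\<close>
    interpret T: two_weight_sparse M ?T E \<eta> N1 N2 b1 b2 P1 P2 by (rule sub_family2) auto
    have "(\<Sum>Q\<in>?T. joint Q * X Q) \<le> (\<Sum>Q\<in>?T. 2 * 2 powr j * X Q)"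
      using k2 X by (intro sum_mono mult_right_mono) auto
    also have "\<dots> = 2 * 2 powr j * (\<Sum>Q\<in>?T. X Q)" by (simp add: sum_distrib_left)
    also have "(\<Sum>Q\<in>?T. X Q) \<le> K * ((2 powr j) powr g1 + (2 powr j) powr g2)"
      unfolding X_def K_def g1_def g2_def
      using k1 k2 \<delta> I \<phi> a1 I1 \<psi> a2 I2 by (intro T.level_sum_le) auto
    also have "2 * 2 powr j * (K * ((2 powr j) powr g1 + (2 powr j) powr g2))
        = 2 * K * (2 powr ((1 + g1) * j) + 2 powr ((1 + g2) * j))"
      by (simp add: powr_powr algebra_simps powr_add)
    finally show ?thesis by simp
  qed
  have geo: "(\<Sum>j\<in>k ` S. 2 powr ((1 + g) * j)) \<le> 2 * L powr (1 + max g1 g2)" if "0 \<le> g" "g \<le> max g1 g2" for g :: real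
  proof -
    have "(\<Sum>j\<in>k ` S. 2 powr ((1 + g) * j)) \<le> L powr (1 + g) / (1 - 2 powr (- (1 + g)))"
    proof (rule sum_powr_geometric_le)
      show "2 powr j \<le> L" if "j \<in> k ` S" for j using that k1 L(1) by force
    qed (use finite_S L that in auto)
    also have "\<dots> \<le> L powr (1 + g) / (1 / 2)"
    proof (rule divide_left_mono)
      have "2 powr (- (1 + g)) \<le> 2 powr (- 1)" using that by (intro powr_mono) auto
      then show h: "1 / 2 \<le> 1 - 2 powr (- (1 + g))" by (simp add: powr_minus)
      then show "0 < (1 - 2 powr (- (1 + g))) * (1 / 2)" by simp
    qed simp
    also have "\<dots> \<le> 2 * L powr (1 + max g1 g2)" using that L by (simp add: powr_mono)
    finally show ?thesis .
  qed
  have "(\<Sum>Q\<in>S. a1 Q powr (P1 + b1) * a2 Q powr (P2 + b2) * (joint Q * lam Q)) = (\<Sum>Q\<in>S. joint Q * X Q)"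
    by (simp add: X_def mult_ac)
  also have "\<dots> = (\<Sum>j\<in>k ` S. \<Sum>Q\<in>{Q\<in>S. k Q = j}. joint Q * X Q)"
    using finite_S by (rule sum.image_gen)
  also have "\<dots> \<le> (\<Sum>j\<in>k ` S. 2 * K * (2 powr ((1 + g1) * j) + 2 powr ((1 + g2) * j)))"
    by (intro sum_mono lev)
  also have "\<dots> = 2 * K * ((\<Sum>j\<in>k ` S. 2 powr ((1 + g1) * j)) + (\<Sum>j\<in>k ` S. 2 powr ((1 + g2) * j)))"
    by (simp add: sum_distrib_left[symmetric] sum.distrib)
  also have "\<dots> \<le> 2 * K * (2 * L powr (1 + max g1 g2) + 2 * L powr (1 + max g1 g2))"
    using K g by (intro mult_left_mono add_mono geo) auto
  finally show ?thesis by (simp add: K_def g1_def g2_def mult_ac)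
qed

end

subsection \<open>Cubes and dyadic lattices\<close>

lemma cube_measurable: "cube a h \<in> sets lebesgue"
proof -
  have "cube a h = (\<Inter>i. {x. a $ i \<le> x $ i} \<inter> {x. x $ i < a $ i + h})"
    by (auto simp: cube_def)
  also have "\<dots> \<in> sets borel"
    by (intro sets.countable_INT' sets.Int borel_closed borel_open closed_Collect_le open_Collect_less continuous_intros)
      auto
  finally show ?thesis by (auto intro: sets_completionI_sets)
qed

lemma emeasure_cube:
  fixes a :: "real ^ 'n::finite"
  assumes "0 < h"
  shows "0 < emeasure lebesgue (cube a h)" "emeasure lebesgue (cube a h) < \<infinity>"
proof -
  have "box a (a + (\<chi> i. h)) \<subseteq> cube a h" by (auto simp: cube_def mem_box_cart less_imp_le)
  then have "emeasure lebesgue (box a (a + (\<chi> i. h))) \<le> emeasure lebesgue (cube a h)"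
    by (intro emeasure_mono cube_measurable)
  moreover have "box a (a + (\<chi> i. h)) \<noteq> {}"
    using assms by (simp add: interval_ne_empty_cart)
  then have "\<not> negligible (box a (a + (\<chi> i. h)))"
    by (simp add: negligible_interval)
  then have "0 < emeasure lebesgue (box a (a + (\<chi> i. h)))"
    by (simp add: negligible_iff_emeasure0 zero_less_iff_neq_zero)
  ultimately show "0 < emeasure lebesgue (cube a h)" by simp
  have "bounded (cube a h)"
  proof (rule bounded_subset[OF bounded_cbox])
    show "cube a h \<subseteq> cbox a (a + (\<chi> i. h))" by (auto simp: cube_def mem_box_cart less_imp_le)
  qed
  then show "emeasure lebesgue (cube a h) < \<infinity>"
    using bounded_set_imp_lmeasurable cube_measurable by (metis fmeasurableD2 infinity_ennreal_def top.not_eq_extremum)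
qed

text \<open>The inductive subdivision speaks of sets; corner and side must be recovered from the set
  before the induction hypothesis can be applied to them.\<close>

lemma cube_eq_iff:
  fixes a :: "real ^ 'n::finite"
  assumes "0 < h" "0 < k" "cube a h = cube b k"
  shows "a = b \<and> h = k"
proof -
  have le: "b $ i \<le> a $ i" if "0 < h" "cube a h = cube b k" for a b :: "real ^ 'n" and h k i
    using that(2)[THEN eqset_imp_iff, of a] that(1) by (auto simp: cube_def)
  have ab: "a = b" using le[OF assms(1,3)] le[OF assms(2) assms(3)[symmetric]]
    by (simp add: vec_eq_iff order_antisym)
  have "k \<le> h" if "0 < h" "0 < k" "cube a h = cube a k" for h k
  proof (rule ccontr)
    assume "\<not> k \<le> h"
    then have "a + (\<chi> i. h) \<in> cube a k" "a + (\<chi> i. h) \<notin> cube a h"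
      using that(1,2) by (auto simp: cube_def)
    then show False using that(3) by simp
  qed
  then show ?thesis using ab assms by (auto intro: order_antisym)
qed

text \<open>Halving turns an index \<open>m i\<close> into \<open>2 * m i\<close> or
  \<open>2 * m i + 1\<close> on the next finer grid, all grids being anchored at the corner of the
  top cube.\<close>

lemma dyadic_subcubes_grid:
  fixes a :: "real ^ 'n::finite"
  assumes "R \<in> dyadic_subcubes (cube a h)" "0 < h"
  shows "\<exists>k (m :: 'n \<Rightarrow> int). R = cube (\<chi> i. a $ i + m i * (h / 2 ^ k)) (h / 2 ^ k)"
  using assms(1)
proof induction
  case self
  show ?case by (rule exI[of _ 0], rule exI[of _ "\<lambda>_. 0"]) (simp add: vec_lambda_eta)
next
  case (subdivide a' h' I)
  then obtain k and m :: "'n \<Rightarrow> int" where "cube a' h' = cube (\<chi> i. a $ i + m i * (h / 2 ^ k)) (h / 2 ^ k)"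
    by blast
  then have eq: "a' = (\<chi> i. a $ i + m i * (h / 2 ^ k))" "h' = h / 2 ^ k"
    using cube_eq_iff[of h' "h / 2 ^ k" a'] subdivide.hyps assms(2) by auto
  have h2: "h' / 2 = h / 2 ^ Suc k" by (simp add: eq)
  have "(\<chi> i. a' $ i + (if i \<in> I then h' / 2 else 0))
      = (\<chi> i. a $ i + (2 * m i + (if i \<in> I then 1 else 0)) * (h / 2 ^ Suc k))"
    by (simp add: vec_eq_iff eq field_simps)
  then show ?case
    unfolding h2 by (intro exI[of _ "Suc k"] exI[of _ "\<lambda>i. 2 * m i + (if i \<in> I then 1 else 0)"]) simp
qed

text \<open>Half-open intervals of a grid are the fibres of a floor function, which reduces nesting
  to integer arithmetic.\<close>

lemma mem_grid_cube_iff: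
  fixes a :: "real ^ 'n::finite" and m :: "'n \<Rightarrow> int"
  assumes "0 < h"
  shows "x \<in> cube (\<chi> i. a $ i + m i * (h / 2 ^ k)) (h / 2 ^ k)
    \<longleftrightarrow> (\<forall>i. \<lfloor>(x $ i - a $ i) / h * 2 ^ k\<rfloor> = m i)"
proof -
  have "(a $ i + m i * (h / 2 ^ k) \<le> x $ i \<and> x $ i < a $ i + m i * (h / 2 ^ k) + h / 2 ^ k)
    \<longleftrightarrow> \<lfloor>(x $ i - a $ i) / h * 2 ^ k\<rfloor> = m i" for i
    using assms by (simp add: floor_eq_iff field_simps)
  then show ?thesis by (auto simp: cube_def)
qed

lemma dyadic_subcubes_nested:
  fixes a :: "real ^ 'n::finite"
  assumes "R \<in> dyadic_subcubes (cube a h)" "R' \<in> dyadic_subcubes (cube a h)" "0 < h"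
  shows "R \<subseteq> R' \<or> R' \<subseteq> R \<or> R \<inter> R' = {}"
proof -
  define z where "z x i = (x $ i - a $ i) / h" for x :: "real ^ 'n" and i
  obtain k and m :: "'n \<Rightarrow> int" where "R = cube (\<chi> i. a $ i + m i * (h / 2 ^ k)) (h / 2 ^ k)"
    using dyadic_subcubes_grid[OF assms(1,3)] by blast
  then have R: "x \<in> R \<longleftrightarrow> (\<forall>i. \<lfloor>z x i * 2 ^ k\<rfloor> = m i)" for x
    using mem_grid_cube_iff[OF assms(3)] by (simp add: z_def)
  obtain k' and m' :: "'n \<Rightarrow> int" where "R' = cube (\<chi> i. a $ i + m' i * (h / 2 ^ k')) (h / 2 ^ k')"
    using dyadic_subcubes_grid[OF assms(2,3)] by blast
  then have R': "x \<in> R' \<longleftrightarrow> (\<forall>i. \<lfloor>z x i * 2 ^ k'\<rfloor> = m' i)" for x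
    using mem_grid_cube_iff[OF assms(3)] by (simp add: z_def)
  \<comment> \<open>Fine floors determine coarse ones. Hence, once two cubes share a point, the
    finer one lies in the coarser one.\<close>
  have coarse: "\<lfloor>y * 2 ^ j\<rfloor> = \<lfloor>y * 2 ^ j'\<rfloor> div 2 ^ (j' - j)" if "j \<le> j'" for y :: real and j j' :: nat
  proof -
    have "(2::real) ^ j' = 2 ^ j * 2 ^ (j' - j)" using that by (simp add: power_add[symmetric])
    then have "y * 2 ^ j = (y * 2 ^ j') / real_of_int (2 ^ (j' - j))" by simp
    then show ?thesis by (simp only: floor_divide_real_eq_div zero_le_power zero_le_numeral)
  qed
  show ?thesis
  proof (cases "R \<inter> R' = {}")
    case False
    then obtain x where x: "x \<in> R" "x \<in> R'" by blast
    show ?thesis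
    proof (cases "k \<le> k'")
      case True
      have "R' \<subseteq> R"
      proof
        fix y assume "y \<in> R'"
        then have "\<lfloor>z y i * 2 ^ k'\<rfloor> = \<lfloor>z x i * 2 ^ k'\<rfloor>" for i using x R' by simp
        then have "\<lfloor>z y i * 2 ^ k\<rfloor> = \<lfloor>z x i * 2 ^ k\<rfloor>" for i using coarse[OF True] by simp
        then show "y \<in> R" using x R by simp
      qed
      then show ?thesis by simp
    next
      case False
      then have le: "k' \<le> k" by simp
      have "R \<subseteq> R'"
      proof
        fix y assume "y \<in> R"
        then have "\<lfloor>z y i * 2 ^ k\<rfloor> = \<lfloor>z x i * 2 ^ k\<rfloor>" for i using x R by simp
        then have "\<lfloor>z y i * 2 ^ k'\<rfloor> = \<lfloor>z x i * 2 ^ k'\<rfloor>" for i using coarse[OF le] by simp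
        then show "y \<in> R'" using x R' by simp
      qed
      then show ?thesis by simp
    qed
  qed simp
qed

lemma dyadic_lattice_laminar:
  fixes \<D> :: "(real ^ 'n::finite) set set"
  assumes "dyadic_lattice \<D>"
  shows "laminar \<D>"
  unfolding laminar_def
proof (intro ballI)
  fix Q R assume "Q \<in> \<D>" "R \<in> \<D>"
  then obtain P where P: "P \<in> \<D>" "Q \<in> dyadic_subcubes P" "R \<in> dyadic_subcubes P"
    using assms unfolding dyadic_lattice_def by metis
  then have "P \<in> cubes" using assms unfolding dyadic_lattice_def by blast
  then obtain a h where "P = cube a h" "0 < h" by (auto simp: cubes_def)
  then show "Q \<subseteq> R \<or> R \<subseteq> Q \<or> Q \<inter> R = {}" using P dyadic_subcubes_nested by blast
qed

subsection \<open>The dual pair of weights\<close>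

lemma ennreal_powr_ennreal:
  assumes "0 \<le> x" "0 < x \<or> 0 < t"
  shows "ennreal_powr (ennreal x) t = ennreal (x powr t)"
  using assms by (auto simp: ennreal_powr_def ennreal_eq_0_iff)

lemma ennreal_powr_1 [simp]: "ennreal_powr x 1 = x"
  by (cases x) (auto simp: ennreal_powr_def)

lemma ennreal_powr_0_pos: "0 < t \<Longrightarrow> ennreal_powr 0 t = 0"
  by (simp add: ennreal_powr_def)

lemma ennreal_powr_top: "0 < t \<Longrightarrow> ennreal_powr \<infinity> t = \<infinity>"
  by (simp add: ennreal_powr_def)

lemma ennreal_powr_inverse:
  assumes "0 < x"
  shows "ennreal_powr (inverse (ennreal x)) c = ennreal (x powr (- c))"
proof -
  have "ennreal_powr (inverse (ennreal x)) c = ennreal_powr (ennreal (inverse x)) c"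
    using assms by (simp add: inverse_ennreal)
  also have "\<dots> = ennreal (inverse x powr c)" using assms by (intro ennreal_powr_ennreal) auto
  finally show ?thesis using assms by (simp add: inverse_powr powr_minus)
qed

lemma wpow_pos: "0 < w x \<Longrightarrow> wpow w a x = ennreal (w x powr a)"
  by (simp add: wpow_def ennreal_powr_ennreal)

lemma emeasure_density_pos:
  assumes meas: "f \<in> borel_measurable M" and pos: "AE x in M. 0 < f x"
    and Q: "Q \<in> sets M" "emeasure M Q \<noteq> 0"
  shows "0 < emeasure (density M (\<lambda>x. ennreal (f x))) Q"
proof (rule ccontr)
  assume "\<not> ?thesis"
  then have "(\<integral>\<^sup>+x. ennreal (f x) * indicator Q x \<partial>M) = 0"
    using meas Q by (simp add: emeasure_density)
  then have "AE x in M. ennreal (f x) * indicator Q x = 0"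
    using meas Q by (subst (asm) nn_integral_0_iff_AE) auto
  then have "AE x in M. x \<notin> Q"
    using pos by eventually_elim (auto simp: indicator_def ennreal_eq_0_iff split: if_splits)
  moreover have "{x \<in> space M. \<not> x \<notin> Q} = Q" using Q sets.sets_into_space by auto
  ultimately show False using Q AE_iff_measurable[of Q M "\<lambda>x. x \<notin> Q"] by simp
qed

text \<open>Weighted AM-GM for \<sigma> and u, each normalised by its mass on \<open>E\<close>, is
  integrated over \<open>E\<close>. The relation \<sigma>^B u^A = 1 makes the geometric mean
  constant.\<close>

lemma Holder_measure:
  fixes \<sigma> u :: "'a \<Rightarrow> real"
  assumes [measurable]: "\<sigma> \<in> borel_measurable M" "u \<in> borel_measurable M"
    and pos: "AE x in M. 0 < \<sigma> x \<and> 0 < u x \<and> \<sigma> x powr B * u x powr A = 1"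
    and AB: "0 < A" "0 < B" and E [measurable]: "E \<in> sets M"
    and fin: "emeasure (density M (\<lambda>x. ennreal (\<sigma> x))) E < \<infinity>" "emeasure (density M (\<lambda>x. ennreal (u x))) E < \<infinity>"
  shows "measure M E powr (B + A)
    \<le> measure (density M (\<lambda>x. ennreal (\<sigma> x))) E powr B * measure (density M (\<lambda>x. ennreal (u x))) E powr A"
proof (cases "measure M E = 0")
  case False
  define n1 where "n1 = measure (density M (\<lambda>x. ennreal (\<sigma> x))) E"
  define n2 where "n2 = measure (density M (\<lambda>x. ennreal (u x))) E"
  define \<theta> where "\<theta> = B / (A + B)"
  have \<theta>: "0 < \<theta>" "\<theta> < 1" "1 - \<theta> = A / (A + B)" using AB by (auto simp: \<theta>_def field_simps)
  have e1: "(\<integral>\<^sup>+x\<in>E. ennreal (\<sigma> x) \<partial>M) = ennreal n1" and e2: "(\<integral>\<^sup>+x\<in>E. ennreal (u x) \<partial>M) = ennreal n2"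
    using fin by (simp_all add: n1_def n2_def emeasure_density[symmetric] emeasure_eq_ennreal_measure)
  have E0: "emeasure M E \<noteq> 0" using False by (auto simp: measure_def)
  have eM: "emeasure M E = ennreal (measure M E)"
    using False by (intro emeasure_finite_of_measure_pos(2)) (simp add: zero_less_measure_iff)
  have "AE x in M. 0 < \<sigma> x" "AE x in M. 0 < u x" using pos by auto
  then have "ennreal n1 > 0" "ennreal n2 > 0"
    using emeasure_density_pos[of \<sigma> M E] emeasure_density_pos[of u M E] E0 e1 e2
    by (simp_all add: emeasure_density)
  then have n: "0 < n1" "0 < n2" by simp_all
  \<comment> \<open>The almost everywhere constant value of (\<sigma>/n1)^\<theta>
    (u/n2)^(1-\<theta>).\<close>
  define k where "k = n1 powr (- \<theta>) * n2 powr (- (1 - \<theta>))"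
  have "ennreal k * emeasure M E = (\<integral>\<^sup>+x. ennreal k * indicator E x \<partial>M)"
    by (simp add: nn_integral_cmult_indicator)
  also have "\<dots> \<le> (\<integral>\<^sup>+x. ennreal (\<theta> / n1) * (ennreal (\<sigma> x) * indicator E x)
      + ennreal ((1 - \<theta>) / n2) * (ennreal (u x) * indicator E x) \<partial>M)"
  proof (rule nn_integral_mono_AE)
    show "AE x in M. ennreal k * indicator E x \<le> ennreal (\<theta> / n1) * (ennreal (\<sigma> x) * indicator E x)
      + ennreal ((1 - \<theta>) / n2) * (ennreal (u x) * indicator E x)"
      using pos
    proof eventually_elim
      case (elim x)
      have "(\<sigma> x powr B * u x powr A) powr (1 / (A + B)) = \<sigma> x powr \<theta> * u x powr (1 - \<theta>)"
        unfolding \<theta>(3) by (simp add: powr_mult powr_powr \<theta>_def)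
      then have "\<sigma> x powr \<theta> * u x powr (1 - \<theta>) = 1" using elim by simp
      then have "k = k * (\<sigma> x powr \<theta> * u x powr (1 - \<theta>))" by simp
      also have "\<dots> = (\<sigma> x / n1) powr \<theta> * (u x / n2) powr (1 - \<theta>)"
        unfolding k_def using elim n by (simp only: powr_divide less_imp_le powr_minus) (simp add: field_simps)
      also have "\<dots> \<le> \<theta> * (\<sigma> x / n1) + (1 - \<theta>) * (u x / n2)"
        using elim n \<theta> by (intro weighted_amgm) auto
      finally have le: "k \<le> \<theta> / n1 * \<sigma> x + (1 - \<theta>) / n2 * u x" by (simp add: field_simps)
      show ?case
      proof (cases "x \<in> E")
        case True
        have "ennreal k \<le> ennreal (\<theta> / n1 * \<sigma> x + (1 - \<theta>) / n2 * u x)" using le by (rule ennreal_leI)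
        also have "\<dots> = ennreal (\<theta> / n1) * ennreal (\<sigma> x) + ennreal ((1 - \<theta>) / n2) * ennreal (u x)"
          using elim n \<theta>(1,2) by (simp add: ennreal_mult[symmetric])
        finally show ?thesis using True by simp
      qed simp
    qed
  qed
  also have "\<dots> = ennreal (\<theta> / n1) * ennreal n1 + ennreal ((1 - \<theta>) / n2) * ennreal n2"
    by (simp add: nn_integral_add nn_integral_cmult e1 e2)
  also have "\<dots> = 1"
    using n \<theta>(1,2) by (simp add: ennreal_mult[symmetric] ennreal_plus[symmetric] del: ennreal_plus)
  finally have "ennreal (k * measure M E) \<le> ennreal 1"
    unfolding eM by (simp add: ennreal_mult k_def)
  then have "k * measure M E \<le> 1" by (subst (asm) ennreal_le_iff) auto
  then have "measure M E \<le> n1 powr \<theta> * n2 powr (1 - \<theta>)"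
    unfolding k_def using n by (simp only: powr_minus) (simp add: field_simps)
  then have "measure M E powr (B + A) \<le> (n1 powr \<theta> * n2 powr (1 - \<theta>)) powr (B + A)"
    using AB by (intro powr_mono2) auto
  also have "\<dots> = n1 powr B * n2 powr A"
  proof -
    have "\<theta> * (B + A) = B" "(1 - \<theta>) * (B + A) = A" using AB unfolding \<theta>(3) by (auto simp: \<theta>_def field_simps)
    then show ?thesis using n by (simp add: powr_mult powr_powr)
  qed
  finally show ?thesis by (simp add: n1_def n2_def)
qed (use AB in simp)

lemma nn_integral_cube_weight_finite:
  fixes w :: "real ^ 'n::finite \<Rightarrow> real"
  assumes "weight w"
  shows "(\<integral>\<^sup>+x\<in>cube a h. ennreal (w x) \<partial>lebesgue) < \<infinity>"
proof -
  let ?K = "cbox a (a + (\<chi> i. h))"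
  have sub: "cube a h \<subseteq> ?K" by (auto simp: cube_def mem_box_cart less_imp_le)
  have w: "0 \<le> w x" for x using assms by (simp add: weight_def)
  have "set_integrable lebesgue ?K w" using assms by (simp add: weight_def)
  then have "(\<integral>\<^sup>+x. ennreal (norm (indicator ?K x *\<^sub>R w x)) \<partial>lebesgue) < \<infinity>"
    unfolding set_integrable_def by (simp add: integrable_iff_bounded)
  moreover have "(\<integral>\<^sup>+x\<in>cube a h. ennreal (w x) \<partial>lebesgue)
      \<le> (\<integral>\<^sup>+x. ennreal (norm (indicator ?K x *\<^sub>R w x)) \<partial>lebesgue)"
  proof (rule nn_integral_mono)
    fix x
    show "ennreal (w x) * indicator (cube a h) x \<le> ennreal (norm (indicator ?K x *\<^sub>R w x))"
      using sub w[of x] by (auto simp: indicator_def)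
  qed
  ultimately show ?thesis by (rule le_less_trans[rotated])
qed

text \<open>For F = |f| and e = c this concerns the factorisation of |f|^\<rho> as \<phi> \<sigma>;
  for F = |g| and e = -t, that of |g|^s' as \<psi> u. The last bound, from \<phi> \<le> 1 +
  \<phi>^m, ensures that averages over cubes are finite.\<close>

lemma
  fixes w F :: "real ^ 'n::finite \<Rightarrow> real" and e \<rho> m :: real
  assumes [measurable]: "w \<in> borel_measurable lebesgue" "F \<in> borel_measurable lebesgue"
    and w: "AE x in lebesgue. 0 < w x" and F: "\<And>x. 0 \<le> F x" and \<rho>: "0 < \<rho>" and m: "1 < m"
  defines "N \<equiv> density lebesgue (\<lambda>x. ennreal (w x powr (- e)))"
    and "\<phi> \<equiv> \<lambda>x. F x powr \<rho> * w x powr e"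
  shows nn_integral_density_ratio_powr:
      "(\<integral>\<^sup>+x. ennreal (\<phi> x powr m) \<partial>N) = (\<integral>\<^sup>+x. ennreal_powr (ennreal (F x)) (\<rho> * m) * wpow w (e * (m - 1)) x \<partial>lebesgue)"
    and nn_integral_density_ratio:
      "Q \<in> sets lebesgue \<Longrightarrow> (\<integral>\<^sup>+x\<in>Q. ennreal (\<phi> x) \<partial>N) = (\<integral>\<^sup>+x\<in>Q. ennreal_powr (ennreal (F x)) \<rho> \<partial>lebesgue)"
    and nn_integral_density_ratio_le:
      "Q \<in> sets lebesgue \<Longrightarrow> (\<integral>\<^sup>+x\<in>Q. ennreal (\<phi> x) \<partial>N) \<le> emeasure N Q + (\<integral>\<^sup>+x. ennreal (\<phi> x powr m) \<partial>N)"
proof -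
  have [measurable]: "\<phi> \<in> borel_measurable lebesgue" unfolding \<phi>_def by measurable
  have \<phi>: "0 \<le> \<phi> x" for x by (simp add: \<phi>_def)
  have "(\<integral>\<^sup>+x. ennreal (\<phi> x powr m) \<partial>N) = (\<integral>\<^sup>+x. ennreal (w x powr (- e)) * ennreal (\<phi> x powr m) \<partial>lebesgue)"
    unfolding N_def by (rule nn_integral_density) measurable
  also have "\<dots> = (\<integral>\<^sup>+x. ennreal_powr (ennreal (F x)) (\<rho> * m) * wpow w (e * (m - 1)) x \<partial>lebesgue)"
  proof (rule nn_integral_cong_AE)
    show "AE x in lebesgue. ennreal (w x powr (- e)) * ennreal (\<phi> x powr m)
        = ennreal_powr (ennreal (F x)) (\<rho> * m) * wpow w (e * (m - 1)) x"
      using w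
    proof eventually_elim
      case (elim x)
      have "w x powr (- e) * \<phi> x powr m = F x powr (\<rho> * m) * (w x powr (- e) * w x powr (e * m))"
        using elim F[of x] by (simp add: \<phi>_def powr_mult powr_powr)
      also have "w x powr (- e) * w x powr (e * m) = w x powr (e * (m - 1))"
        by (simp add: powr_add[symmetric] algebra_simps)
      finally show ?case
        using F[of x] elim \<rho> m by (simp add: wpow_pos ennreal_powr_ennreal ennreal_mult[symmetric])
    qed
  qed
  finally show "(\<integral>\<^sup>+x. ennreal (\<phi> x powr m) \<partial>N) = (\<integral>\<^sup>+x. ennreal_powr (ennreal (F x)) (\<rho> * m) * wpow w (e * (m - 1)) x \<partial>lebesgue)" .
  assume Q [measurable]: "Q \<in> sets lebesgue"
  have "(\<integral>\<^sup>+x\<in>Q. ennreal (\<phi> x) \<partial>N) = (\<integral>\<^sup>+x. ennreal (w x powr (- e)) * (ennreal (\<phi> x) * indicator Q x) \<partial>lebesgue)"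
    unfolding N_def by (rule nn_integral_density) measurable
  also have "\<dots> = (\<integral>\<^sup>+x\<in>Q. ennreal_powr (ennreal (F x)) \<rho> \<partial>lebesgue)"
  proof (rule nn_integral_cong_AE)
    show "AE x in lebesgue. ennreal (w x powr (- e)) * (ennreal (\<phi> x) * indicator Q x)
        = ennreal_powr (ennreal (F x)) \<rho> * indicator Q x"
      using w
    proof eventually_elim
      case (elim x)
      have "w x powr (- e) * \<phi> x = F x powr \<rho>"
        using elim by (simp add: \<phi>_def powr_minus)
      then have "ennreal (w x powr (- e)) * ennreal (\<phi> x) = ennreal_powr (ennreal (F x)) \<rho>"
        using F[of x] \<rho> \<phi>[of x] by (simp add: ennreal_powr_ennreal ennreal_mult[symmetric])
      then show ?case by (simp add: mult.assoc[symmetric])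
    qed
  qed
  finally show "(\<integral>\<^sup>+x\<in>Q. ennreal (\<phi> x) \<partial>N) = (\<integral>\<^sup>+x\<in>Q. ennreal_powr (ennreal (F x)) \<rho> \<partial>lebesgue)" .
  have QN [measurable]: "Q \<in> sets N" "\<phi> \<in> borel_measurable N" by (simp_all add: N_def)
  have "(\<integral>\<^sup>+x\<in>Q. ennreal (\<phi> x) \<partial>N) \<le> (\<integral>\<^sup>+x. indicator Q x + ennreal (\<phi> x powr m) \<partial>N)"
  proof (rule nn_integral_mono)
    fix x
    have "\<phi> x \<le> 1 + \<phi> x powr m"
    proof (cases "\<phi> x \<le> 1")
      case False
      then have "\<phi> x powr 1 \<le> \<phi> x powr m" using m by (intro powr_mono) auto
      then show ?thesis using False by simp
    qed (simp add: add_increasing2)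
    then have "ennreal (\<phi> x) \<le> 1 + ennreal (\<phi> x powr m)"
      by (subst ennreal_1[symmetric], subst ennreal_plus[symmetric]) (auto intro: ennreal_leI simp del: ennreal_1 ennreal_plus)
    then show "ennreal (\<phi> x) * indicator Q x \<le> indicator Q x + ennreal (\<phi> x powr m)"
      by (auto simp: indicator_def)
  qed
  also have "\<dots> = emeasure N Q + (\<integral>\<^sup>+x. ennreal (\<phi> x powr m) \<partial>N)"
    by (subst nn_integral_add) auto
  finally show "(\<integral>\<^sup>+x\<in>Q. ennreal (\<phi> x) \<partial>N) \<le> emeasure N Q + (\<integral>\<^sup>+x. ennreal (\<phi> x powr m) \<partial>N)" .
qed

text \<open>Here \<open>a\<close> is q/r, \<open>c\<close> is 1/(qB) and \<open>t\<close> is (s/q)'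
  = 1/(qA). Positivity almost everywhere makes negative powers of \<open>w\<close> real-valued
  outside a null set.\<close>

locale ap_rh_weight =
  fixes w :: "real ^ 'n::finite \<Rightarrow> real" and a c t :: real
  assumes weight: "weight w" and w_pos: "AE x in lebesgue. 0 < w x"
    and Ap_finite: "Ap_const a w < \<infinity>" and RH_finite: "RH_const t w < \<infinity>"
    and a_c: "1 / (a - 1) = c" and c_pos: "0 < c" and t_pos: "0 < t"
begin

definition N1 :: "(real ^ 'n) measure" where "N1 = density lebesgue (\<lambda>x. ennreal (w x powr (- c)))"
definition N2 :: "(real ^ 'n) measure" where "N2 = density lebesgue (\<lambda>x. ennreal (w x powr t))"

definition K :: real where "K = enn2real (Ap_const a w) * enn2real (RH_const t w)"

lemma w_measurable [measurable]: "w \<in> borel_measurable lebesgue"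
  using weight by (simp add: weight_def)

lemma sets_N [simp]: "sets N1 = sets lebesgue" "sets N2 = sets lebesgue"
  by (simp_all add: N1_def N2_def)

lemma cubes_sets: "Q \<in> cubes \<Longrightarrow> Q \<in> sets lebesgue"
  by (auto simp: cubes_def cube_measurable)

lemma emeasure_cubes:
  assumes "Q \<in> cubes"
  shows "emeasure lebesgue Q = ennreal (measure lebesgue Q)" "0 < measure lebesgue Q"
proof -
  obtain a h where "Q = cube a h" "0 < h" using assms by (auto simp: cubes_def)
  then have *: "0 < emeasure lebesgue Q" "emeasure lebesgue Q < \<infinity>" using emeasure_cube by auto
  then show 1: "emeasure lebesgue Q = ennreal (measure lebesgue Q)"
    by (intro emeasure_eq_ennreal_measure) auto
  show "0 < measure lebesgue Q" using * by (simp add: 1)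
qed

lemma N_pos:
  assumes "Q \<in> cubes"
  shows "0 < emeasure N1 Q" "0 < emeasure N2 Q"
proof -
  have "AE x in lebesgue. 0 < w x powr (- c)" "AE x in lebesgue. 0 < w x powr t"
    using w_pos by auto
  moreover have "emeasure lebesgue Q \<noteq> 0" using emeasure_cubes[OF assms] by simp
  ultimately show "0 < emeasure N1 Q" "0 < emeasure N2 Q"
    unfolding N1_def N2_def using cubes_sets[OF assms] by (intro emeasure_density_pos; simp)+
qed

text \<open>The average z of \<open>w\<close> cancels: one factor times z is bounded by the A
  constant, the other divided by z by the RH constant. As z is positive and finite, an infinite mass
  of \<open>N1\<close> or \<open>N2\<close> would make one of these constants infinite.\<close>

lemma N_cube:
  assumes Q: "Q \<in> cubes"
  shows "emeasure N1 Q < \<infinity>" "emeasure N2 Q < \<infinity>"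
    and "(measure N1 Q / measure lebesgue Q) powr (1 / c) * (measure N2 Q / measure lebesgue Q) powr (1 / t) \<le> K"
proof -
  have [measurable]: "Q \<in> sets lebesgue" using Q by (rule cubes_sets)
  define m where "m = measure lebesgue Q"
  have m: "0 < m" "emeasure lebesgue Q = ennreal m" using emeasure_cubes[OF Q] by (auto simp: m_def)
  define W where "W = (\<integral>\<^sup>+x\<in>Q. ennreal (w x) \<partial>lebesgue)"
  have "W < \<infinity>" unfolding W_def using Q nn_integral_cube_weight_finite[OF weight] by (auto simp: cubes_def)
  moreover have "0 < W"
    using emeasure_density_pos[OF w_measurable w_pos \<open>Q \<in> sets lebesgue\<close>] m
    by (simp add: W_def emeasure_density)
  ultimately obtain W' where W': "W = ennreal W'" "0 < W'"
    by (cases W) auto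
  define z where "z = W' / m"
  have z: "0 < z" using W' m by (simp add: z_def)
  have avg1: "cube_avg 1 Q (\<lambda>x. ennreal (w x)) = ennreal z"
    using W' m by (simp add: cube_avg_def W_def[symmetric] z_def divide_ennreal)
  have "(\<integral>\<^sup>+x\<in>Q. ennreal_powr (inverse (ennreal (w x))) c \<partial>lebesgue) = emeasure N1 Q"
  proof -
    have "(\<integral>\<^sup>+x\<in>Q. ennreal_powr (inverse (ennreal (w x))) c \<partial>lebesgue)
      = (\<integral>\<^sup>+x\<in>Q. ennreal (w x powr (- c)) \<partial>lebesgue)"
      using w_pos by (intro nn_integral_cong_AE) (auto simp: ennreal_powr_inverse)
    then show ?thesis by (simp add: N1_def emeasure_density)
  qed
  then have avgc: "cube_avg (1 / (a - 1)) Q (\<lambda>x. inverse (ennreal (w x))) = ennreal_powr (emeasure N1 Q / ennreal m) (1 / c)"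
    by (simp add: cube_avg_def a_c m)
  have "(\<integral>\<^sup>+x\<in>Q. ennreal_powr (ennreal (w x)) t \<partial>lebesgue) = emeasure N2 Q"
  proof -
    have "(\<integral>\<^sup>+x\<in>Q. ennreal_powr (ennreal (w x)) t \<partial>lebesgue)
      = (\<integral>\<^sup>+x\<in>Q. ennreal (w x powr t) \<partial>lebesgue)"
      using w_pos by (intro nn_integral_cong_AE) (auto simp: ennreal_powr_ennreal)
    then show ?thesis by (simp add: N2_def emeasure_density)
  qed
  then have avgt: "cube_avg t Q (\<lambda>x. ennreal (w x)) = ennreal_powr (emeasure N2 Q / ennreal m) (1 / t)"
    by (simp add: cube_avg_def m)
  have Ap: "ennreal z * ennreal_powr (emeasure N1 Q / ennreal m) (1 / c) \<le> Ap_const a w"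
    unfolding Ap_const_def avg1[symmetric] avgc[symmetric] using Q by (rule SUP_upper)
  have RH: "ennreal_powr (emeasure N2 Q / ennreal m) (1 / t) / ennreal z \<le> RH_const t w"
    unfolding RH_const_def avg1[symmetric] avgt[symmetric] using Q by (rule SUP_upper)
  show f1: "emeasure N1 Q < \<infinity>"
  proof (rule ccontr)
    assume "\<not> ?thesis"
    then have "emeasure N1 Q / ennreal m = \<infinity>" by (simp add: top.not_eq_extremum[symmetric] ennreal_top_divide)
    then show False using Ap Ap_finite z c_pos by (simp add: ennreal_powr_top[unfolded infinity_ennreal_def] ennreal_mult_top ennreal_eq_0_iff top_unique)
  qed
  show f2: "emeasure N2 Q < \<infinity>"
  proof (rule ccontr)
    assume "\<not> ?thesis"
    then have "emeasure N2 Q / ennreal m = \<infinity>" by (simp add: top.not_eq_extremum[symmetric] ennreal_top_divide)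
    then show False using RH RH_finite z t_pos by (simp add: ennreal_powr_top[unfolded infinity_ennreal_def] ennreal_top_divide top_unique)
  qed
  define X where "X = (measure N1 Q / m) powr (1 / c)"
  define Y where "Y = (measure N2 Q / m) powr (1 / t)"
  have X: "ennreal_powr (emeasure N1 Q / ennreal m) (1 / c) = ennreal X"
    using f1 m c_pos by (simp add: X_def emeasure_eq_ennreal_measure divide_ennreal ennreal_powr_ennreal)
  have Y: "ennreal_powr (emeasure N2 Q / ennreal m) (1 / t) = ennreal Y"
    using f2 m t_pos by (simp add: Y_def emeasure_eq_ennreal_measure divide_ennreal ennreal_powr_ennreal)
  have "ennreal (z * X) \<le> Ap_const a w" using Ap z by (simp add: X ennreal_mult X_def)
  then have 1: "z * X \<le> enn2real (Ap_const a w)"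
    using enn2real_mono[OF _ Ap_finite[unfolded infinity_ennreal_def]] z by (fastforce simp: X_def)
  have "ennreal (Y / z) \<le> RH_const t w" using RH z by (simp add: Y divide_ennreal Y_def)
  then have 2: "Y / z \<le> enn2real (RH_const t w)"
    using enn2real_mono[OF _ RH_finite[unfolded infinity_ennreal_def]] z by (fastforce simp: Y_def)
  have "X * Y = (z * X) * (Y / z)" using z by simp
  also have "\<dots> \<le> K" unfolding K_def using 1 2 z by (intro mult_mono) (auto simp: X_def Y_def)
  finally show "(measure N1 Q / measure lebesgue Q) powr (1 / c) * (measure N2 Q / measure lebesgue Q) powr (1 / t) \<le> K"
    by (simp add: X_def Y_def m_def)
qed

lemma N_measure:
  assumes "Q \<in> cubes"
  shows "0 < measure N1 Q" "0 < measure N2 Q"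
    "emeasure N1 Q = ennreal (measure N1 Q)" "emeasure N2 Q = ennreal (measure N2 Q)"
proof -
  show 1: "emeasure N1 Q = ennreal (measure N1 Q)" "emeasure N2 Q = ennreal (measure N2 Q)"
    using N_cube(1,2)[OF assms] by (simp_all add: emeasure_eq_ennreal_measure)
  show "0 < measure N1 Q" "0 < measure N2 Q"
    using N_pos[OF assms] unfolding 1 by simp_all
qed

text \<open>\<open>b1 * c = b2 * t\<close> is the condition under which the powers of
  \<open>w\<close> cancel.\<close>

lemma Holder_N:
  assumes bc: "b1 * c = b2 * t" "0 < b1" "0 < b2"
    and Q: "Q \<in> cubes" "E' \<subseteq> Q" and E: "E' \<in> sets lebesgue"
  shows "measure lebesgue E' powr (b1 + b2) \<le> measure N1 E' powr b1 * measure N2 E' powr b2"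
  unfolding N1_def N2_def
proof (rule Holder_measure)
  show "AE x in lebesgue. 0 < w x powr (- c) \<and> 0 < w x powr t \<and> (w x powr (- c)) powr b1 * (w x powr t) powr b2 = 1"
    using w_pos
  proof eventually_elim
    case (elim x)
    have "(w x powr (- c)) powr b1 * (w x powr t) powr b2 = w x powr (- (b1 * c) + b2 * t)"
      by (simp only: powr_powr powr_add[symmetric]) (simp add: mult.commute)
    then show ?case using elim bc by simp
  qed
  have "emeasure N1 E' \<le> emeasure N1 Q" "emeasure N2 E' \<le> emeasure N2 Q"
    using Q cubes_sets[OF Q(1)] by (intro emeasure_mono; simp)+
  then show "emeasure (density lebesgue (\<lambda>x. ennreal (w x powr (- c)))) E' < \<infinity>"
    "emeasure (density lebesgue (\<lambda>x. ennreal (w x powr t))) E' < \<infinity>"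
    using N_cube(1,2)[OF Q(1)] unfolding N1_def N2_def by (auto intro: le_less_trans)
qed (use bc E in auto)

text \<open>Hoelder on the whole cube, with exponents 1/c and 1/t.\<close>

lemma one_le_K:
  assumes Q: "(Q :: (real ^ 'n) set) \<in> cubes"
  shows "1 \<le> K"
proof -
  define m where "m = measure lebesgue Q"
  have m: "0 < m" using emeasure_cubes[OF Q] by (simp add: m_def)
  have "m powr (1 / c + 1 / t) \<le> measure N1 Q powr (1 / c) * measure N2 Q powr (1 / t)"
    unfolding m_def using Q cubes_sets c_pos t_pos by (intro Holder_N) auto
  then have "1 \<le> (measure N1 Q / m) powr (1 / c) * (measure N2 Q / m) powr (1 / t)"
    using m by (simp add: powr_divide powr_add)
  then show ?thesis using N_cube(3)[OF Q] by (simp add: m_def)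
qed

end

section \<open>Averages with respect to a density, and the form over finite families\<close>

definition davg :: "'a measure \<Rightarrow> ('a \<Rightarrow> real) \<Rightarrow> 'a set \<Rightarrow> real" where
  "davg N \<phi> Q = enn2real (\<integral>\<^sup>+x\<in>Q. ennreal (\<phi> x) \<partial>N) / measure N Q"

lemma davg_nonneg: "0 \<le> davg N \<phi> Q"
  by (simp add: davg_def)

lemma davg_times_emeasure:
  assumes "0 < measure N Q" "(\<integral>\<^sup>+x\<in>Q. ennreal (\<phi> x) \<partial>N) < \<infinity>"
  shows "ennreal (davg N \<phi> Q) * emeasure N Q = (\<integral>\<^sup>+x\<in>Q. ennreal (\<phi> x) \<partial>N)"
proof -
  have "ennreal (davg N \<phi> Q) * emeasure N Q = ennreal (davg N \<phi> Q * measure N Q)"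
    by (simp add: emeasure_finite_of_measure_pos(2)[OF assms(1)] davg_nonneg ennreal_mult)
  also have "davg N \<phi> Q * measure N Q = enn2real (\<integral>\<^sup>+x\<in>Q. ennreal (\<phi> x) \<partial>N)"
    using assms by (simp add: davg_def)
  finally show ?thesis using assms by simp
qed

lemma cube_avg_eq_davg:
  assumes y: "0 < y" and N: "0 < measure N Q" and v: "emeasure lebesgue Q = ennreal v" "0 < v"
    and fin: "(\<integral>\<^sup>+x\<in>Q. ennreal (\<phi> x) \<partial>N) < \<infinity>"
    and eq: "(\<integral>\<^sup>+x\<in>Q. ennreal (\<phi> x) \<partial>N) = (\<integral>\<^sup>+x\<in>Q. ennreal_powr (F x) (1 / y) \<partial>lebesgue)"
  shows "cube_avg (1 / y) Q F = ennreal ((davg N \<phi> Q * (measure N Q / v)) powr y)"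
proof -
  define I where "I = enn2real (\<integral>\<^sup>+x\<in>Q. ennreal (\<phi> x) \<partial>N)"
  have I: "(\<integral>\<^sup>+x\<in>Q. ennreal_powr (F x) (1 / y) \<partial>lebesgue) = ennreal I"
    using fin by (simp add: I_def eq[symmetric])
  have "0 \<le> I" by (simp add: I_def)
  have "cube_avg (1 / y) Q F = ennreal_powr (ennreal (I / v)) y"
    using v \<open>0 \<le> I\<close> by (simp add: cube_avg_def I divide_ennreal)
  also have "\<dots> = ennreal ((I / v) powr y)" using v \<open>0 \<le> I\<close> y by (intro ennreal_powr_ennreal) auto
  also have "I / v = davg N \<phi> Q * (measure N Q / v)" using N by (simp add: davg_def I_def)
  finally show ?thesis .
qed

context ap_rh_weight
begin

lemma finite_sparse_form_le:
  fixes A B P1 P2 \<delta> \<eta> :: real and f g :: "real ^ 'n \<Rightarrow> complex"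
  assumes AB: "0 < A" "0 < B" and P: "0 < P1" "P1 < 1" "0 < P2" "P2 < 1" "1 \<le> P1 + P2"
    and c: "c = (1 - P2) / B" and t: "t = (1 - P2) / A"
    and \<delta>: "0 < \<delta>" "P1 + P2 - 1 < \<delta> * (B + A)" "\<delta> * B < P1" "\<delta> * A < P2"
    and S: "finite S" "laminar S" "sparse_family \<eta> S" and \<eta>: "0 < \<eta>"
    and f: "f \<in> Lp_space (1 / P1) (wpow w (c * B / P1))"
    and g: "g \<in> Lp_space (1 / P2) (wpow w (- (t * A / P2)))"
  shows "(\<Sum>Q\<in>S. cube_avg (1 / (P1 + B)) Q (\<lambda>x. ennreal (cmod (f x))) *
      cube_avg (1 / (P2 + A)) Q (\<lambda>x. ennreal (cmod (g x))) * ennreal_powr (emeasure lebesgue Q) (P1 + P2))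
    \<le> ennreal (8 * core_const \<eta> B A P1 P2 \<delta>) *
       ennreal (K powr ((1 - P2) * (1 + max ((1 - P2) / B) ((1 - P1) / A)))) *
       Lp_norm (1 / P1) (wpow w (c * B / P1)) f * Lp_norm (1 / P2) (wpow w (- (t * A / P2))) g"
proof -
  define \<phi> where "\<phi> x = cmod (f x) powr (1 / (P1 + B)) * w x powr c" for x
  define \<psi> where "\<psi> x = cmod (g x) powr (1 / (P2 + A)) * w x powr (- t)" for x
  define m1 where "m1 = (P1 + B) / P1"
  define m2 where "m2 = (P2 + A) / P2"
  have m: "1 < m1" "1 < m2" using AB P by (auto simp: m1_def m2_def field_simps)
  have y: "0 < P1 + B" "0 < P2 + A" using AB P by auto
  have [measurable]: "f \<in> borel_measurable lebesgue" "g \<in> borel_measurable lebesgue"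
    using f g by (simp_all add: Lp_space_def)
  have fm: "(\<lambda>x. cmod (f x)) \<in> borel_measurable lebesgue" "(\<lambda>x. cmod (g x)) \<in> borel_measurable lebesgue"
    by measurable
  have \<phi>: "\<phi> \<in> borel_measurable N1" "0 \<le> \<phi> x" and \<psi>: "\<psi> \<in> borel_measurable N2" "0 \<le> \<psi> x" for x
    unfolding N1_def N2_def \<phi>_def \<psi>_def by auto
  define J1 where "J1 = (\<integral>\<^sup>+x. ennreal (\<phi> x powr m1) \<partial>N1)"
  define J2 where "J2 = (\<integral>\<^sup>+x. ennreal (\<psi> x powr m2) \<partial>N2)"
  \<comment> \<open>Since m1 - 1 = B/P1 and m2 - 1 = A/P2 while c B = t A = 1 - P2, the densities
    are w^(p/q) and w^(1-q').\<close>
  have e1: "1 / (P1 + B) * m1 = 1 / P1" "c * (m1 - 1) = c * B / P1"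
    and e2: "1 / (P2 + A) * m2 = 1 / P2" "- t * (m2 - 1) = - (t * A / P2)"
    using y P by (simp_all add: m1_def m2_def field_simps)
  have J1: "J1 = (\<integral>\<^sup>+x. ennreal_powr (ennreal (cmod (f x))) (1 / P1) * wpow w (c * B / P1) x \<partial>lebesgue)"
    unfolding J1_def \<phi>_def N1_def e1[symmetric]
    by (rule nn_integral_density_ratio_powr) (use fm w_pos m y in auto)
  have J2: "J2 = (\<integral>\<^sup>+x. ennreal_powr (ennreal (cmod (g x))) (1 / P2) * wpow w (- (t * A / P2)) x \<partial>lebesgue)"
    unfolding J2_def \<psi>_def N2_def e2[symmetric]
    by (rule nn_integral_density_ratio_powr[where e = "- t", simplified minus_minus]) (use fm w_pos m y in auto)
  have nf: "Lp_norm (1 / P1) (wpow w (c * B / P1)) f = ennreal_powr J1 P1"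
    and ng: "Lp_norm (1 / P2) (wpow w (- (t * A / P2))) g = ennreal_powr J2 P2"
    using P by (simp_all add: Lp_norm_def J1 J2)
  have "J1 < \<infinity>" "J2 < \<infinity>"
  proof -
    have "ennreal_powr J1 P1 < \<infinity>" "ennreal_powr J2 P2 < \<infinity>"
      using f g unfolding Lp_space_def nf[symmetric] ng[symmetric] by auto
    then have "J1 \<noteq> \<infinity>" "J2 \<noteq> \<infinity>" using P ennreal_powr_top by (metis order_less_irrefl)+
    then show "J1 < \<infinity>" "J2 < \<infinity>" by (simp_all add: top.not_eq_extremum)
  qed
  then obtain I1 I2 where I: "J1 = ennreal I1" "J2 = ennreal I2" "0 \<le> I1" "0 \<le> I2"
    by (metis ennreal_cases infinity_ennreal_def order_less_irrefl)
  have nf': "Lp_norm (1 / P1) (wpow w (c * B / P1)) f = ennreal (I1 powr P1)"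
    and ng': "Lp_norm (1 / P2) (wpow w (- (t * A / P2))) g = ennreal (I2 powr P2)"
    using P I by (simp_all add: nf ng ennreal_powr_ennreal)
  have S_cubes: "S \<subseteq> cubes" using S by (simp add: sparse_family_def)
  obtain E where E: "\<And>Q. Q \<in> S \<Longrightarrow> E Q \<in> sets lebesgue" "\<And>Q. Q \<in> S \<Longrightarrow> E Q \<subseteq> Q"
      "\<And>Q. Q \<in> S \<Longrightarrow> ennreal \<eta> * emeasure lebesgue Q \<le> emeasure lebesgue (E Q)"
      "disjoint_family_on E S"
    using S(3) unfolding sparse_family_def by blast
  have int_eq: "(\<integral>\<^sup>+x\<in>Q. ennreal (\<phi> x) \<partial>N1) = (\<integral>\<^sup>+x\<in>Q. ennreal_powr (ennreal (cmod (f x))) (1 / (P1 + B)) \<partial>lebesgue)"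
      "(\<integral>\<^sup>+x\<in>Q. ennreal (\<psi> x) \<partial>N2) = (\<integral>\<^sup>+x\<in>Q. ennreal_powr (ennreal (cmod (g x))) (1 / (P2 + A)) \<partial>lebesgue)"
    and int_fin: "(\<integral>\<^sup>+x\<in>Q. ennreal (\<phi> x) \<partial>N1) < \<infinity>" "(\<integral>\<^sup>+x\<in>Q. ennreal (\<psi> x) \<partial>N2) < \<infinity>"
    if "Q \<in> cubes" for Q
  proof -
    have Q: "Q \<in> sets lebesgue" using that by (rule cubes_sets)
    show "(\<integral>\<^sup>+x\<in>Q. ennreal (\<phi> x) \<partial>N1) = (\<integral>\<^sup>+x\<in>Q. ennreal_powr (ennreal (cmod (f x))) (1 / (P1 + B)) \<partial>lebesgue)"
      unfolding \<phi>_def N1_def by (rule nn_integral_density_ratio[where m = m1]) (use Q fm w_pos m y in auto)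
    show "(\<integral>\<^sup>+x\<in>Q. ennreal (\<psi> x) \<partial>N2) = (\<integral>\<^sup>+x\<in>Q. ennreal_powr (ennreal (cmod (g x))) (1 / (P2 + A)) \<partial>lebesgue)"
      unfolding \<psi>_def N2_def
      by (rule nn_integral_density_ratio[where m = m2 and e = "- t", simplified minus_minus]) (use Q fm w_pos m y in auto)
    have "(\<integral>\<^sup>+x\<in>Q. ennreal (\<phi> x) \<partial>N1) \<le> emeasure N1 Q + J1"
      unfolding J1_def \<phi>_def N1_def by (rule nn_integral_density_ratio_le) (use Q fm w_pos m y in auto)
    also have "\<dots> < \<infinity>" using N_cube(1)[OF that] \<open>J1 < \<infinity>\<close> by simp
    finally show "(\<integral>\<^sup>+x\<in>Q. ennreal (\<phi> x) \<partial>N1) < \<infinity>" .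
    have "(\<integral>\<^sup>+x\<in>Q. ennreal (\<psi> x) \<partial>N2) \<le> emeasure N2 Q + J2"
      unfolding J2_def \<psi>_def N2_def
      by (rule nn_integral_density_ratio_le[where e = "- t", simplified minus_minus]) (use Q fm w_pos m y in auto)
    also have "\<dots> < \<infinity>" using N_cube(2)[OF that] \<open>J2 < \<infinity>\<close> by simp
    finally show "(\<integral>\<^sup>+x\<in>Q. ennreal (\<psi> x) \<partial>N2) < \<infinity>" .
  qed
  define a1 where "a1 = davg N1 \<phi>"
  define a2 where "a2 = davg N2 \<psi>"
  \<comment> \<open>Levels are logarithms of averages, so both must be positive; the discarded cubes
    contribute zero.\<close>
  define T where "T = {Q \<in> S. 0 < a1 Q \<and> 0 < a2 Q}"
  have T: "T \<subseteq> S" by (auto simp: T_def)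
  have TQ: "Q \<in> cubes" if "Q \<in> T" for Q using that T S_cubes by auto
  interpret sp: sparse_laminar lebesgue S E \<eta>
  proof
    show "0 < measure lebesgue Q" if "Q \<in> S" for Q using that S_cubes emeasure_cubes by blast
    show "\<eta> * measure lebesgue Q \<le> measure lebesgue (E Q)" if "Q \<in> S" for Q
    proof -
      have Q: "Q \<in> cubes" using that S_cubes by auto
      have "emeasure lebesgue (E Q) \<le> emeasure lebesgue Q"
        using E that cubes_sets[OF Q] by (intro emeasure_mono) auto
      also have "\<dots> < \<infinity>" using emeasure_cubes[OF Q] by simp
      finally have "emeasure lebesgue (E Q) = ennreal (measure lebesgue (E Q))"
        by (intro emeasure_eq_ennreal_measure) auto
      then have "ennreal (\<eta> * measure lebesgue Q) \<le> ennreal (measure lebesgue (E Q))"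
        using E(3)[OF that] emeasure_cubes[OF Q] \<eta> by (simp add: ennreal_mult)
      then show ?thesis by (subst (asm) ennreal_le_iff) auto
    qed
    show "S \<subseteq> sets lebesgue" using S_cubes cubes_sets by blast
  qed (use S E \<eta> in auto)
  have bc: "B * c = A * t" using AB by (simp add: c t)
  interpret two_weight_sparse lebesgue S E \<eta> N1 N2 B A P1 P2
  proof
    show "measure lebesgue (E Q) powr (B + A) \<le> measure N1 (E Q) powr B * measure N2 (E Q) powr A"
      if "Q \<in> S" for Q
      using Holder_N[OF bc AB(2,1)] E that S_cubes by blast
  qed (use AB P N_measure S_cubes in auto)
  interpret T: two_weight_sparse lebesgue T E \<eta> N1 N2 B A P1 P2
    using T by (rule sub_family2)
  define L where "L = K powr (1 - P2)"
  define X where "X Q = a1 Q powr (P1 + B) * a2 Q powr (P2 + A) * (joint Q * lam Q)" for Q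
  have X_nonneg: "0 \<le> X Q" for Q by (simp add: X_def joint_def lam_nonneg)
  have term_eq: "cube_avg (1 / (P1 + B)) Q (\<lambda>x. ennreal (cmod (f x))) *
      cube_avg (1 / (P2 + A)) Q (\<lambda>x. ennreal (cmod (g x))) * ennreal_powr (emeasure lebesgue Q) (P1 + P2)
    = ennreal (X Q)" if "Q \<in> S" for Q
  proof -
    have Q: "Q \<in> cubes" using that S_cubes by auto
    define v where "v = measure lebesgue Q"
    define n1 where "n1 = measure N1 Q"
    define n2 where "n2 = measure N2 Q"
    have pos: "0 < v" "emeasure lebesgue Q = ennreal v" "0 < n1" "0 < n2" "0 \<le> a1 Q" "0 \<le> a2 Q"
      using emeasure_cubes[OF Q] N_measure[OF Q] by (auto simp: v_def n1_def n2_def a1_def a2_def davg_nonneg)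
    have "cube_avg (1 / (P1 + B)) Q (\<lambda>x. ennreal (cmod (f x))) = ennreal ((a1 Q * (n1 / v)) powr (P1 + B))"
      unfolding a1_def n1_def
      by (rule cube_avg_eq_davg) (use y pos int_eq[OF Q] int_fin[OF Q] N_measure[OF Q] in auto)
    moreover have "cube_avg (1 / (P2 + A)) Q (\<lambda>x. ennreal (cmod (g x))) = ennreal ((a2 Q * (n2 / v)) powr (P2 + A))"
      unfolding a2_def n2_def
      by (rule cube_avg_eq_davg) (use y pos int_eq[OF Q] int_fin[OF Q] N_measure[OF Q] in auto)
    moreover have "ennreal_powr (emeasure lebesgue Q) (P1 + P2) = ennreal (v powr (P1 + P2))"
      using pos by (simp add: ennreal_powr_ennreal)
    \<comment> \<open>The volume factor cancels the P1 + P2 part of the exponents of 1/v; only the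
      powers B and A remain, and they form \<open>joint\<close>.\<close>
    moreover have "(a1 Q * (n1 / v)) powr (P1 + B) * (a2 Q * (n2 / v)) powr (P2 + A) * v powr (P1 + P2) = X Q"
      unfolding X_def joint_def lam_def n1_def[symmetric] n2_def[symmetric] v_def[symmetric]
      using pos by (simp add: powr_mult powr_divide powr_add field_simps)
    ultimately show ?thesis by (simp add: ennreal_mult[symmetric])
  qed
  have L: "1 \<le> L"
  proof -
    have "cube 0 1 \<in> (cubes :: (real ^ 'n) set set)" unfolding cubes_def by force
    then show ?thesis unfolding L_def using P one_le_K by (intro ge_one_powr_ge_zero) auto
  qed
  have joint_L: "T.joint Q \<le> L" if "Q \<in> T" for Q
  proof -
    define v where "v = measure lebesgue Q"
    have pos: "0 < v" "0 < measure N1 Q" "0 < measure N2 Q"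
      using emeasure_cubes[OF TQ[OF that]] N_measure[OF TQ[OF that]] by (auto simp: v_def)
    \<comment> \<open>B = (1 - P2)/c and A = (1 - P2)/t, so \<open>joint\<close> is the power 1 -
      P2, that is 1/q, of the quantity bounded by \<open>K\<close>.\<close>
    have "T.joint Q = ((measure N1 Q / v) powr (1 / c) * (measure N2 Q / v) powr (1 / t)) powr (1 - P2)"
      unfolding T.joint_def v_def[symmetric] using P AB pos by (simp add: powr_mult powr_powr c t)
    also have "\<dots> \<le> L"
      unfolding L_def v_def using P N_cube(3)[OF TQ[OF that]] by (intro powr_mono2) auto
    finally show ?thesis .
  qed
  have "(\<Sum>Q\<in>S. X Q) = (\<Sum>Q\<in>T. X Q)"
  proof (rule sum.mono_neutral_right)
    show "\<forall>Q\<in>S - T. X Q = 0"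
    proof
      fix Q assume "Q \<in> S - T"
      then have "a1 Q = 0 \<or> a2 Q = 0"
        using davg_nonneg[of N1 \<phi> Q] davg_nonneg[of N2 \<psi> Q] by (force simp: T_def a1_def a2_def)
      then show "X Q = 0" by (auto simp: X_def)
    qed
  qed (use S T in auto)
  also have "\<dots> \<le> 8 * core_const \<eta> B A P1 P2 \<delta> * L powr (1 + max ((1 - P2) / B) ((1 - P1) / A)) *
       (I1 powr P1 * I2 powr P2)"
    unfolding X_def
  proof (rule T.sparse_form_le)
    show "ennreal (a1 Q) * emeasure N1 Q \<le> (\<integral>\<^sup>+x\<in>Q. ennreal (\<phi> x) \<partial>N1)" if "Q \<in> T" for Q
      using davg_times_emeasure[OF N_measure(1) int_fin(1), OF TQ[OF that] TQ[OF that]] by (simp add: a1_def)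
    show "ennreal (a2 Q) * emeasure N2 Q \<le> (\<integral>\<^sup>+x\<in>Q. ennreal (\<psi> x) \<partial>N2)" if "Q \<in> T" for Q
      using davg_times_emeasure[OF N_measure(2) int_fin(2), OF TQ[OF that] TQ[OF that]] by (simp add: a2_def)
    show "(\<integral>\<^sup>+x. ennreal (\<phi> x powr ((P1 + B) / P1)) \<partial>N1) \<le> ennreal I1"
      "(\<integral>\<^sup>+x. ennreal (\<psi> x powr ((P2 + A) / P2)) \<partial>N2) \<le> ennreal I2"
      using I by (simp_all add: J1_def J2_def m1_def m2_def)
  qed (use \<delta> L joint_L I \<phi> \<psi> in \<open>auto simp: T_def\<close>)
  also have "L powr (1 + max ((1 - P2) / B) ((1 - P1) / A)) = K powr ((1 - P2) * (1 + max ((1 - P2) / B) ((1 - P1) / A)))"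
    by (simp add: L_def powr_powr)
  finally have "ennreal (\<Sum>Q\<in>S. X Q) \<le> ennreal (8 * core_const \<eta> B A P1 P2 \<delta> *
      K powr ((1 - P2) * (1 + max ((1 - P2) / B) ((1 - P1) / A))) * (I1 powr P1 * I2 powr P2))"
    by (rule ennreal_leI)
  moreover have "0 \<le> core_const \<eta> B A P1 P2 \<delta>" using \<eta> \<delta> by (intro core_const_nonneg)
  moreover have "(\<Sum>Q\<in>S. cube_avg (1 / (P1 + B)) Q (\<lambda>x. ennreal (cmod (f x))) *
      cube_avg (1 / (P2 + A)) Q (\<lambda>x. ennreal (cmod (g x))) * ennreal_powr (emeasure lebesgue Q) (P1 + P2))
    = ennreal (\<Sum>Q\<in>S. X Q)"
    using X_nonneg by (simp add: term_eq sum_ennreal cong: sum.cong)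
  ultimately show ?thesis
    by (simp add: nf' ng' ennreal_mult mult.assoc)
qed

end

text \<open>The zero weight belongs to every class, since \<open>0 * \<infinity> = 0\<close> and \<open>0 / 0 = 0\<close> in \<open>ennreal\<close>.\<close>

lemma weight_AE_zero_or_pos:
  fixes w :: "real ^ 'n::finite \<Rightarrow> real"
  assumes weight: "weight w" and Ap: "Ap_const a w < \<infinity>" and a: "0 < 1 / (a - 1)"
  shows "(AE x in lebesgue. w x = 0) \<or> (AE x in lebesgue. 0 < w x)"
proof (cases "AE x in lebesgue. w x = 0")
  case False
  define c where "c = 1 / (a - 1)"
  have c: "0 < c" using a by (simp add: c_def)
  have [measurable]: "w \<in> borel_measurable lebesgue" and w: "0 \<le> w x" for x
    using weight by (simp_all add: weight_def)
  \<comment> \<open>Centred cubes exhausting the space; \<open>Suc\<close> keeps the side positive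
    for k = 0.\<close>
  define Q :: "nat \<Rightarrow> (real ^ 'n) set" where "Q k = cube (\<chi> i. - real (Suc k)) (2 * real (Suc k))" for k
  have Q: "Q k \<in> cubes" for k unfolding Q_def cubes_def by force
  have [measurable]: "Q k \<in> sets lebesgue" for k by (simp add: Q_def cube_measurable)
  have Q_mono: "Q k \<subseteq> Q l" if "k \<le> l" for k l
  proof
    fix x assume x: "x \<in> Q k"
    have "- real (Suc l) \<le> x $ i \<and> x $ i < - real (Suc l) + 2 * real (Suc l)" for i
    proof -
      have "- real (Suc k) \<le> x $ i" "x $ i < - real (Suc k) + 2 * real (Suc k)"
        using x unfolding Q_def cube_def mem_Collect_eq vec_lambda_beta by blast+
      moreover have "real k \<le> real l" using that by simp
      ultimately show ?thesis unfolding of_nat_Suc by auto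
    qed
    then show "x \<in> Q l" by (simp add: Q_def cube_def)
  qed
  have Q_cover: "\<exists>k. x \<in> Q k" for x
  proof -
    obtain k :: nat where k: "norm x < k" using reals_Archimedean2 by blast
    have "- real (Suc k) \<le> x $ i \<and> x $ i < - real (Suc k) + 2 * real (Suc k)" for i
    proof -
      have "\<bar>x $ i\<bar> < real k" using component_le_norm_cart[of x i] k by linarith
      then show ?thesis unfolding of_nat_Suc by auto
    qed
    then show ?thesis by (auto simp: Q_def cube_def)
  qed
  have "\<exists>k. (\<integral>\<^sup>+x\<in>Q k. ennreal (w x) \<partial>lebesgue) \<noteq> 0"
  proof (rule ccontr)
    assume "\<not> ?thesis"
    then have "AE x in lebesgue. ennreal (w x) * indicator (Q k) x = 0" for k
      by (subst nn_integral_0_iff_AE[symmetric]) auto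
    then have "AE x in lebesgue. \<forall>k. ennreal (w x) * indicator (Q k) x = 0"
      unfolding AE_all_countable by blast
    then have "AE x in lebesgue. w x = 0"
    proof eventually_elim
      case (elim x)
      obtain k where "x \<in> Q k" using Q_cover by blast
      then show ?case using elim[rule_format, of k] w[of x] by (simp add: ennreal_eq_0_iff)
    qed
    then show False using False by simp
  qed
  then obtain k0 where k0: "(\<integral>\<^sup>+x\<in>Q k0. ennreal (w x) \<partial>lebesgue) \<noteq> 0" by blast
  \<comment> \<open>On a cube containing \<open>Q k0\<close> the average of \<open>w\<close> is
    nonzero, so a finite A constant forces the dual average to be finite, and \<open>w\<close>
    cannot vanish there on a set of positive measure.\<close>
  have "AE x in lebesgue. k0 \<le> k \<longrightarrow> x \<in> Q k \<longrightarrow> 0 < w x" for k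
  proof (cases "k0 \<le> k")
    case True
    define W where "W = (\<integral>\<^sup>+x\<in>Q k. ennreal (w x) \<partial>lebesgue)"
    define V where "V = (\<integral>\<^sup>+x\<in>Q k. ennreal_powr (inverse (ennreal (w x))) c \<partial>lebesgue)"
    define m where "m = emeasure lebesgue (Q k)"
    have m: "0 < m" "m < \<infinity>" unfolding m_def Q_def by (intro emeasure_cube; simp)+
    have "(\<integral>\<^sup>+x\<in>Q k0. ennreal (w x) \<partial>lebesgue) \<le> W"
      unfolding W_def using Q_mono[OF True] by (intro nn_integral_mono) (auto simp: indicator_def)
    then have "W \<noteq> 0" using k0 by auto
    then have Wm: "W / m \<noteq> 0" using m by (simp add: ennreal_divide_eq_0_iff)
    have "cube_avg 1 (Q k) (\<lambda>x. ennreal (w x)) * cube_avg c (Q k) (\<lambda>x. inverse (ennreal (w x))) \<le> Ap_const a w"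
      unfolding Ap_const_def c_def using Q by (rule SUP_upper)
    then have fin: "W / m * ennreal_powr (V / m) (1 / c) < \<infinity>"
      using Ap by (simp add: cube_avg_def W_def V_def m_def)
    have "V \<noteq> \<infinity>"
    proof
      assume "V = \<infinity>"
      then have "ennreal_powr (V / m) (1 / c) = \<infinity>"
        using less_imp_neq[OF m(2)] c by (simp add: ennreal_top_divide ennreal_powr_top[unfolded infinity_ennreal_def])
      then show False using fin Wm by (simp add: ennreal_mult_top)
    qed
    moreover have "(\<lambda>x. ennreal_powr (inverse (ennreal (w x))) c * indicator (Q k) x) \<in> borel_measurable lebesgue"
    proof -
      have eq: "ennreal_powr (inverse (ennreal (w x))) c = (if w x = 0 then \<infinity> else ennreal (w x powr (- c)))" for x
        using w[of x] c by (auto simp: ennreal_powr_inverse ennreal_powr_top[unfolded infinity_ennreal_def])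
      show ?thesis unfolding eq by measurable
    qed
    ultimately have "AE x in lebesgue. ennreal_powr (inverse (ennreal (w x))) c * indicator (Q k) x \<noteq> \<infinity>"
      unfolding V_def by (intro nn_integral_PInf_AE) auto
    then show ?thesis
    proof eventually_elim
      case (elim x)
      show ?case
      proof (intro impI)
        assume "x \<in> Q k"
        then have "ennreal_powr (inverse (ennreal (w x))) c \<noteq> \<infinity>" using elim by simp
        then have "w x \<noteq> 0" using c by (auto simp: ennreal_powr_top[unfolded infinity_ennreal_def])
        then show "0 < w x" using w[of x] by simp
      qed
    qed
  qed simp
  then have "AE x in lebesgue. \<forall>k. k0 \<le> k \<longrightarrow> x \<in> Q k \<longrightarrow> 0 < w x"
    by (simp add: AE_all_countable)
  then have "AE x in lebesgue. 0 < w x"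
  proof eventually_elim
    case (elim x)
    obtain k where "x \<in> Q k" using Q_cover by blast
    then have "x \<in> Q (max k k0)" using Q_mono[of k "max k k0"] by auto
    then show ?case using elim[rule_format, of "max k k0"] by simp
  qed
  then show ?thesis by simp
qed simp

text \<open>A negative power of the zero weight is \<infinity> almost everywhere, so a finite norm
  forces g = 0. In the theorem the exponent is 1 - q' < 0, which settles the degenerate
  weight.\<close>

lemma cube_avg_eq_0_of_weight_zero:
  fixes w :: "real ^ 'n::finite \<Rightarrow> real"
  assumes w: "AE x in lebesgue. w x = 0" and g: "g \<in> Lp_space d (wpow w e)"
    and d: "0 < d" and e: "e < 0" and z: "0 < z"
  shows "cube_avg z Q (\<lambda>x. ennreal (cmod (g x))) = 0"
proof -
  have [measurable]: "g \<in> borel_measurable lebesgue" using g by (simp add: Lp_space_def)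
  define J where "J = (\<integral>\<^sup>+x. ennreal_powr (ennreal (cmod (g x))) d * wpow w e x \<partial>lebesgue)"
  have "ennreal_powr J (1 / d) < \<infinity>" using g by (simp add: Lp_space_def Lp_norm_def J_def)
  then have "J \<noteq> \<infinity>" using ennreal_powr_top[of "1 / d"] d by auto
  have "J = (\<integral>\<^sup>+x. ennreal (cmod (g x) powr d) * \<infinity> \<partial>lebesgue)"
    unfolding J_def
  proof (rule nn_integral_cong_AE)
    show "AE x in lebesgue. ennreal_powr (ennreal (cmod (g x))) d * wpow w e x = ennreal (cmod (g x) powr d) * \<infinity>"
      using w
    proof eventually_elim
      case (elim x)
      then show ?case using d e by (simp add: wpow_def ennreal_powr_ennreal) (simp add: ennreal_powr_def)
    qed
  qed
  also have "\<dots> = (\<integral>\<^sup>+x. ennreal (cmod (g x) powr d) \<partial>lebesgue) * \<infinity>"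
    by (rule nn_integral_multc) measurable
  finally have "(\<integral>\<^sup>+x. ennreal (cmod (g x) powr d) \<partial>lebesgue) = 0"
    using \<open>J \<noteq> \<infinity>\<close> by (auto simp: ennreal_mult_top split: if_splits)
  then have "AE x in lebesgue. ennreal (cmod (g x) powr d) = 0"
    by (subst (asm) nn_integral_0_iff_AE) auto
  then have g0: "AE x in lebesgue. g x = 0"
    by eventually_elim (metis ennreal_eq_0_iff order_antisym powr_ge_zero powr_eq_0_iff norm_eq_zero)
  have "(\<integral>\<^sup>+x\<in>Q. ennreal_powr (ennreal (cmod (g x))) z \<partial>lebesgue) = (\<integral>\<^sup>+(x :: real ^ 'n). 0 \<partial>lebesgue)"
  proof (rule nn_integral_cong_AE)
    show "AE x in lebesgue. ennreal_powr (ennreal (cmod (g x))) z * indicator Q x = 0"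
      using g0 by eventually_elim (simp add: ennreal_powr_0_pos[OF z])
  qed
  then show ?thesis using z by (simp add: cube_avg_def ennreal_powr_0_pos)
qed

theorem theorem4p1:
  fixes r p q \<alpha> \<beta> \<eta> :: real and s :: ereal
  assumes "1 \<le> r" and "r < p" and "p \<le> q" and "ereal q < s"
    and "0 < \<eta>" and "\<eta> < 1"
    and "\<alpha> = r / p - r / q"
    and "\<beta> = max (if s = \<infinity> then 1 - \<alpha> / r
                  else (real_of_ereal s * (1 - \<alpha> / r) - 1) / (real_of_ereal s - q))
                 (1 / (q - r))"
  shows "\<exists>C::real. 0 < C \<and>
    (\<forall>(w :: real ^ 'n \<Rightarrow> real) \<D> \<S> f g.
       w \<in> Ap_class (q / r) \<longrightarrow> w \<in> RH_class (hconj (s / ereal q)) \<longrightarrow>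
       dyadic_lattice \<D> \<longrightarrow> \<S> \<subseteq> \<D> \<longrightarrow> sparse_family \<eta> \<S> \<longrightarrow>
       f \<in> Lp_space p (wpow w (p / q)) \<longrightarrow>
       g \<in> Lp_space (hconj (ereal q)) (wpow w (1 - hconj (ereal q))) \<longrightarrow>
       (\<Sum>\<^sub>\<infinity>Q\<in>\<S>. cube_avg (r / (1 + \<alpha>)) Q (\<lambda>x. ennreal (cmod (f x))) *
                 cube_avg (hconj s) Q (\<lambda>x. ennreal (cmod (g x))) *
                 ennreal_powr (emeasure lebesgue Q) (1 + \<alpha> / r))
       \<le> ennreal C * ennreal_powr (Ap_const (q / r) w) \<beta> *
           ennreal_powr (RH_const (hconj (s / ereal q)) w) \<beta> *
           Lp_norm p (wpow w (p / q)) f *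
           Lp_norm (hconj (ereal q)) (wpow w (1 - hconj (ereal q))) g)"
proof -
  have ineq: "0 < r" "r < p" "p \<le> q" "1 < p" "1 < q" "r < q" using assms by auto
  define P1 where "P1 = 1 / p"
  define P2 where "P2 = 1 - 1 / q"
  define B where "B = 1 / r - 1 / q"
  define A where "A = (if s = \<infinity> then 1 / q else 1 / q - 1 / real_of_ereal s)"
  define c where "c = (1 - P2) / B"
  define t where "t = (1 - P2) / A"
  have P: "0 < P1" "P1 < 1" "0 < P2" "P2 < 1" "1 \<le> P1 + P2"
    using ineq by (auto simp: P1_def P2_def field_simps)
  have B: "0 < B" using ineq by (simp add: B_def field_simps)
  have s_cases: "s = \<infinity> \<or> (\<exists>\<sigma>. s = ereal \<sigma> \<and> q < \<sigma>)"
    using assms(4) by (cases s) auto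
  have A: "0 < A" using s_cases ineq by (auto simp: A_def field_simps)
  have c: "1 / (q / r - 1) = c" "0 < c" using ineq by (auto simp: c_def P2_def B_def field_simps)
  have t_pos: "0 < t" using A P by (simp add: t_def)
  have ht: "hconj (s / ereal q) = t"
    using s_cases ineq by (auto simp: hconj_def t_def P2_def A_def field_simps)
  have hs: "hconj s = 1 / (P2 + A)"
    using s_cases ineq by (auto simp: hconj_def P2_def A_def field_simps)
  have hq: "hconj (ereal q) = 1 / P2" using ineq by (simp add: hconj_def P2_def field_simps)
  have hq': "1 - 1 / P2 = - (t * A / P2)" using ineq A by (simp add: t_def P2_def field_simps)
  have pq: "p = 1 / P1" "p / q = c * B / P1" using ineq B by (auto simp: P1_def c_def P2_def)
  have ar: "\<alpha> / r = 1 / p - 1 / q" using assms(7) ineq by (simp add: field_simps)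
  have r1: "r / (1 + \<alpha>) = 1 / (P1 + B)"
  proof -
    have "1 / r * (1 + \<alpha>) = 1 / r + \<alpha> / r" using ineq by (simp add: field_simps)
    also have "\<dots> = P1 + B" by (simp add: ar P1_def B_def)
    finally show ?thesis using ineq by (metis divide_divide_eq_right divide_divide_eq_left mult_1 times_divide_eq_left)
  qed
  have r2: "1 + \<alpha> / r = P1 + P2" by (simp add: ar P1_def P2_def)
  \<comment> \<open>The entry 1/(q-r) is the cost of \<sigma>, through 1/B; the entry with s is the
    cost of u, through 1/A.\<close>
  have \<beta>: "\<beta> = (1 - P2) * (1 + max ((1 - P2) / B) ((1 - P1) / A))"
  proof -
    have 1: "1 / (q - r) = (1 - P2) * (1 + (1 - P2) / B)"
      using ineq by (simp add: P2_def B_def field_simps)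
    have 2: "(if s = \<infinity> then 1 - \<alpha> / r
        else (real_of_ereal s * (1 - \<alpha> / r) - 1) / (real_of_ereal s - q)) = (1 - P2) * (1 + (1 - P1) / A)"
      using s_cases
    proof
      assume "s = \<infinity>"
      then show ?thesis using ineq by (simp add: ar A_def P1_def P2_def field_simps)
    next
      assume "\<exists>\<sigma>. s = ereal \<sigma> \<and> q < \<sigma>"
      then obtain \<sigma> where \<sigma>: "s = ereal \<sigma>" "q < \<sigma>" by blast
      have A': "A = (\<sigma> - q) / (q * \<sigma>)" using \<sigma> ineq by (simp add: A_def field_simps)
      show ?thesis unfolding A' ar P1_def P2_def using \<sigma> ineq by (simp add: field_simps)
    qed
    show ?thesis unfolding assms(8) 1 2 using P
      by (auto simp: max_def mult_le_cancel_left)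
  qed
  \<comment> \<open>The midpoint of the interval of admissible values, which is nonempty because P1
    and P2 lie strictly between 0 and 1.\<close>
  define \<delta> where "\<delta> = ((P1 + P2 - 1) / (B + A) + min (P1 / B) (P2 / A)) / 2"
  have \<delta>: "0 < \<delta>" "P1 + P2 - 1 < \<delta> * (B + A)" "\<delta> * B < P1" "\<delta> * A < P2"
  proof -
    have "(P1 + P2 - 1) * B < P1 * (B + A)" "(P1 + P2 - 1) * A < P2 * (B + A)"
    proof -
      have "(P1 + P2 - 1) * B < P1 * B" "(P1 + P2 - 1) * A < P2 * A" using P A B by auto
      moreover have "0 < P1 * A" "0 < P2 * B" using P A B by auto
      ultimately show "(P1 + P2 - 1) * B < P1 * (B + A)" "(P1 + P2 - 1) * A < P2 * (B + A)"
        by (auto simp: distrib_left)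
    qed
    then have lt: "(P1 + P2 - 1) / (B + A) < min (P1 / B) (P2 / A)"
      using A B by (simp add: field_simps)
    have mid: "x < (x + y) / 2" "(x + y) / 2 < y" if "x < y" for x y :: real using that by auto
    have l: "(P1 + P2 - 1) / (B + A) < \<delta>" unfolding \<delta>_def using lt by (rule mid)
    have "\<delta> < min (P1 / B) (P2 / A)" unfolding \<delta>_def using lt by (rule mid)
    then have u: "\<delta> < P1 / B" "\<delta> < P2 / A" by simp_all
    show "P1 + P2 - 1 < \<delta> * (B + A)" using l A B by (simp add: field_simps)
    show "\<delta> * B < P1" "\<delta> * A < P2" using u A B by (simp_all add: field_simps)
    have "0 \<le> (P1 + P2 - 1) / (B + A)" using P A B by simp
    then show "0 < \<delta>" using l by linarith
  qed
  \<comment> \<open>The summand 1 makes \<open>C\<close> strictly positive,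
    \<open>core_const\<close> being known only to be nonnegative.\<close>
  define C where "C = 8 * core_const \<eta> B A P1 P2 \<delta> + 1"
  have C0: "0 \<le> core_const \<eta> B A P1 P2 \<delta>" using assms(5) \<delta>(2) by (intro core_const_nonneg)
  show ?thesis
    unfolding r1 r2 hs ht hq hq' pq(2)
  proof (subst (1 2) pq(1), intro exI[of _ C] conjI allI impI)
    show "0 < C" using C0 by (simp add: C_def)
    fix w :: "real ^ 'n \<Rightarrow> real" and \<D> \<S> :: "(real ^ 'n) set set" and f g :: "real ^ 'n \<Rightarrow> complex"
    assume w1: "w \<in> Ap_class (q / r)" and w2: "w \<in> RH_class t" and D: "dyadic_lattice \<D>" and SD: "\<S> \<subseteq> \<D>"
      and sp: "sparse_family \<eta> \<S>" and f: "f \<in> Lp_space (1 / P1) (wpow w (c * B / P1))"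
      and g: "g \<in> Lp_space (1 / P2) (wpow w (- (t * A / P2)))"
    let ?a = "\<lambda>Q. cube_avg (1 / (P1 + B)) Q (\<lambda>x. ennreal (cmod (f x))) *
      cube_avg (1 / (P2 + A)) Q (\<lambda>x. ennreal (cmod (g x))) * ennreal_powr (emeasure lebesgue Q) (P1 + P2)"
    let ?R = "ennreal C * ennreal_powr (Ap_const (q / r) w) \<beta> * ennreal_powr (RH_const t w) \<beta> *
      Lp_norm (1 / P1) (wpow w (c * B / P1)) f * Lp_norm (1 / P2) (wpow w (- (t * A / P2))) g"
    have weight: "weight w" and Ap: "Ap_const (q / r) w < \<infinity>" and RH: "RH_const t w < \<infinity>"
      using w1 w2 by (auto simp: Ap_class_def RH_class_def)
    \<comment> \<open>In \<open>ennreal\<close> the infinite sum is the supremum of the finite ones,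
      and \<open>?R\<close> does not depend on \<open>F\<close>.\<close>
    have "sum ?a F \<le> ?R" if F: "finite F" "F \<subseteq> \<S>" for F
    proof (cases "AE x in lebesgue. w x = 0")
      case True
      have "0 < t * A / P2" using t_pos A P by simp
      then have "cube_avg (1 / (P2 + A)) Q (\<lambda>x. ennreal (cmod (g x))) = 0" for Q
        using P A g by (intro cube_avg_eq_0_of_weight_zero[OF True g]) auto
      then show ?thesis by simp
    next
      case False
      then have w_pos: "AE x in lebesgue. 0 < w x"
        using weight_AE_zero_or_pos[OF weight Ap] c by auto
      interpret W: ap_rh_weight w "q / r" c t
        by standard (use weight w_pos Ap RH c t_pos in auto)
      have "laminar F" using dyadic_lattice_laminar[OF D] F SD laminar_subset by blast
      moreover have "sparse_family \<eta> F"
        using sp F disjoint_family_on_mono[OF F(2)] unfolding sparse_family_def by blast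
      ultimately have "sum ?a F \<le> ennreal (8 * core_const \<eta> B A P1 P2 \<delta>) * ennreal (W.K powr \<beta>) *
        Lp_norm (1 / P1) (wpow w (c * B / P1)) f * Lp_norm (1 / P2) (wpow w (- (t * A / P2))) g"
        unfolding \<beta> using A B P \<delta> F assms(5) f g
        by (intro W.finite_sparse_form_le) (simp_all add: c_def t_def)
      also have "\<dots> \<le> ennreal C * ennreal (W.K powr \<beta>) *
        Lp_norm (1 / P1) (wpow w (c * B / P1)) f * Lp_norm (1 / P2) (wpow w (- (t * A / P2))) g"
        by (intro mult_right_mono ennreal_leI) (simp_all add: C_def)
      also have "ennreal (W.K powr \<beta>) = ennreal_powr (Ap_const (q / r) w) \<beta> * ennreal_powr (RH_const t w) \<beta>"
      proof -
        have "cube 0 1 \<in> (cubes :: (real ^ 'n) set set)" unfolding cubes_def by force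
        then have "1 \<le> W.K" by (rule W.one_le_K)
        obtain x y where xy: "Ap_const (q / r) w = ennreal x" "RH_const t w = ennreal y" "0 \<le> x" "0 \<le> y"
          using Ap RH by (metis ennreal_cases infinity_ennreal_def order_less_irrefl)
        then have K: "W.K = x * y" by (simp add: W.K_def)
        \<comment> \<open>From 1 \<le> x y neither constant vanishes, so the power of the product
          splits.\<close>
        then have "0 < x" "0 < y" using \<open>1 \<le> W.K\<close> xy
          by (metis less_eq_real_def mult_zero_left mult_zero_right not_one_le_zero)+
        then show ?thesis
          by (simp add: xy K ennreal_powr_ennreal ennreal_mult[symmetric] powr_mult)
      qed
      finally show ?thesis by (simp add: mult.assoc)
    qed
    then show "infsum ?a \<S> \<le> ?R"
      by (subst nonneg_infsum_complete) (auto intro!: SUP_least)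
  qed
qed

end
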